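(* Let $\mathcal{A}$ be an abelian category with small $\operatorname{Ext}$ groups and $\mathcal{E}$ an exact structure on $\mathcal{A}$ such that $\mathcal{A}$ has enough $\mathcal{E}$-projectives and enough $\mathcal{E}$-injectives. Let $(\mathcal{X},\mathcal{Y})$ be a complete hereditary (classical) cotorsion pair in $\mathcal{A}$. Then: (1) If $\mathcal{X}$ contains the $\mathcal{E}$-projective objects of $\mathcal{A}$, then $(\mathcal{X},\mathcal{X}^{\bot_{\ast}})$ is a complete hereditary $\mathcal{E}$-cotorsion pair and each $A\in\mathcal{A}$ admits a monomorphic $\mathcal{X}^{\bot_{\ast}}$-preenvelope $j:A\to Y$ such that $\operatorname{Coker} j\in\mathcal{X}$. (2) If $\mathcal{Y}$ contains the $\mathcal{E}$-injective objects of $\mathcal{A}$, then $({}^{\bot_{\ast}}\mathcal{Y},\mathcal{Y})$ is a complete hereditary $\mathcal{E}$-cotorsion pair and each $A\in\mathcal{A}$ admits an epimorphic ${}^{\bot_{\ast}}\mathcal{Y}$-precover $p:X\to A$ such that $\operatorname{Ker} p\in\mathcal{Y}$.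
   Context: Small Ext groups: $\operatorname{Ext}^1_{\mathcal{A}}(X,Y)$ is a set for all $X,Y$. A subcategory of $\mathcal{A}$ means a full and additive subcategory closed under isomorphisms and direct summands. Exact structure: a kernel-cokernel pair $(i,p)$ is a composable pair $L\xrightarrow{i}M\xrightarrow{p}N$ with $i$ a kernel of $p$ and $p$ a cokernel of $i$. For a class $\mathcal{E}$ of such pairs, $i$ (resp. $p$) is an admissible monic (resp. admissible epic) if it is the first (resp. second) morphism of a pair in $\mathcal{E}$. $\mathcal{E}$ is an exact structure if it is closed under isomorphisms and: identities are both admissible monics and admissible epics; admissible monics (resp. epics) are closed under composition; push-outs of admissible monics along arbitrary morphisms exist and are admissible monics; pull-backs of admissible epics along arbitrary morphisms exist and are admissible epics. Elements of $\mathcal{E}$ are called conflations. $P$ is $\mathcal{E}$-projective if every morphism $P\to N$ lifts along every admissible epic $M\to N$; $I$ is $\mathcal{E}$-injective if every morphism $L\to I$ extends along every admissible monic $L\to M$. Enough $\mathcal{E}$-projectives (resp. $\mathcal{E}$-injectives): every object $M$ admits an admissible epic $P\to M$ with $P$ $\mathcal{E}$-projective (resp. an admissible monic $M\to I$ with $I$ $\mathcal{E}$-injective). $\mathcal{E}\mathrm{xt}^{i}_{\mathcal{A}}(M,N)$, $i\ge 1$, is the $i$-th cohomology group obtained by applying $\operatorname{Hom}_{\mathcal{A}}(-,N)$ to an $\mathcal{E}$-projective resolution of $M$ (built from conflations), or equivalently $\operatorname{Hom}_{\mathcal{A}}(M,-)$ to an $\mathcal{E}$-injective coresolution of $N$.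 Put $\mathcal{X}^{\bot_{\ast}}=\{N\in\mathcal{A}\mid \mathcal{E}\mathrm{xt}^1_{\mathcal{A}}(M,N)=0 \text{ for all } M\in\mathcal{X}\}$ and ${}^{\bot_{\ast}}\mathcal{Y}=\{M\in\mathcal{A}\mid \mathcal{E}\mathrm{xt}^1_{\mathcal{A}}(M,N)=0\text{ for all }N\in\mathcal{Y}\}$. A pair $(\mathcal{U},\mathcal{V})$ of full subcategories is an $\mathcal{E}$-cotorsion pair if $\mathcal{U}={}^{\bot_{\ast}}\mathcal{V}$ and $\mathcal{V}=\mathcal{U}^{\bot_{\ast}}$. It is complete if for every $M\in\mathcal{A}$ there are conflations $0\to V\to U\to M\to 0$ and $0\to M\to V'\to U'\to 0$ with $U,U'\in\mathcal{U}$, $V,V'\in\mathcal{V}$. It is hereditary if $\mathcal{U}$ is $\mathcal{E}$-resolving, i.e. contains all $\mathcal{E}$-projectives, is closed under $\mathcal{E}$-extensions (the middle term of a conflation lies in $\mathcal{U}$ if both end terms do), and for every conflation $0\to X\to Y\to Z\to 0$ with $Y,Z\in\mathcal{U}$ one has $X\in\mathcal{U}$. A (complete, hereditary) classical cotorsion pair is defined by the same conditions with all short exact sequences of $\mathcal{A}$ in place of conflations, $\operatorname{Ext}^1_{\mathcal{A}}$ in place of $\mathcal{E}\mathrm{xt}^1_{\mathcal{A}}$, and projective objects in place of $\mathcal{E}$-projectives. A $\mathcal{U}$-precover of $A$ is a morphism $p:U\to A$ with $U\in\mathcal{U}$ such that every morphism $U'\to A$ with $U'\in\mathcal{U}$ factors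 through $p$; a $\mathcal{V}$-preenvelope of $A$ is a morphism $j:A\to V$ with $V\in\mathcal{V}$ such that every morphism $A\to V'$ with $V'\in\mathcal{V}$ factors through $j$. Epimorphic (resp. monomorphic) means that the morphism is an epimorphism (resp. monomorphism) in $\mathcal{A}$. *)

theory Defs
  imports "HOL-Algebra.Elementary_Groups"
begin

section \<open>Preadditive and abelian categories\<close>

text \<open>The addition \<open>Add\<close>, like the composition \<open>f \<cdot> g\<close> (first \<open>g\<close>, then \<open>f\<close>), is only
  meaningful where it makes sense: for parallel, respectively composable, morphisms.
  \<open>Zer C A B\<close> is the zero morphism from \<open>A\<close> to \<open>B\<close>.\<close>

record ('o, 'm) precat =
  Obj  :: "'o set"
  Mor  :: "'m set"
  Dom  :: "'m \<Rightarrow> 'o"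
  Cod  :: "'m \<Rightarrow> 'o"
  Id   :: "'o \<Rightarrow> 'm"
  Comp :: "'m \<Rightarrow> 'm \<Rightarrow> 'm"  (infixr \<open>\<cdot>\<index>\<close> 70)
  Add  :: "'m \<Rightarrow> 'm \<Rightarrow> 'm"  (infixl \<open>\<boxplus>\<index>\<close> 65)
  Zer  :: "'o \<Rightarrow> 'o \<Rightarrow> 'm"

definition Hom :: "('o, 'm) precat \<Rightarrow> 'o \<Rightarrow> 'o \<Rightarrow> 'm set" where
  "Hom C A B = {f \<in> Mor C. Dom C f = A \<and> Cod C f = B}"

definition Hom_group :: "('o, 'm) precat \<Rightarrow> 'o \<Rightarrow> 'o \<Rightarrow> 'm monoid" where
  "Hom_group C A B = \<lparr>carrier = Hom C A B, mult = Add C, one = Zer C A B\<rparr>"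

locale category =
  fixes C :: "('o, 'm) precat" (structure)
  assumes Dom_in_Obj: "f \<in> Mor C \<Longrightarrow> Dom C f \<in> Obj C"
    and Cod_in_Obj: "f \<in> Mor C \<Longrightarrow> Cod C f \<in> Obj C"
    and Id_in_Hom: "A \<in> Obj C \<Longrightarrow> Id C A \<in> Hom C A A"
    and Comp_in_Hom: "\<lbrakk>g \<in> Hom C A B; f \<in> Hom C B D\<rbrakk> \<Longrightarrow> f \<cdot> g \<in> Hom C A D"
    and Comp_Id: "f \<in> Hom C A B \<Longrightarrow> f \<cdot> Id C A = f"
    and Id_Comp: "f \<in> Hom C A B \<Longrightarrow> Id C B \<cdot> f = f"
    and Comp_assoc: "\<lbrakk>h \<in> Hom C A B; g \<in> Hom C B D; f \<in> Hom C D E\<rbrakk>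
                      \<Longrightarrow> (f \<cdot> g) \<cdot> h = f \<cdot> (g \<cdot> h)"

locale preadditive_category = category +
  assumes Hom_comm_group: "\<lbrakk>A \<in> Obj C; B \<in> Obj C\<rbrakk> \<Longrightarrow> comm_group (Hom_group C A B)"
    and Comp_Add: "\<lbrakk>g \<in> Hom C A B; h \<in> Hom C A B; f \<in> Hom C B D\<rbrakk>
                    \<Longrightarrow> f \<cdot> (g \<boxplus> h) = (f \<cdot> g) \<boxplus> (f \<cdot> h)"
    and Add_Comp: "\<lbrakk>h \<in> Hom C A B; f \<in> Hom C B D; g \<in> Hom C B D\<rbrakk>
                    \<Longrightarrow> (f \<boxplus> g) \<cdot> h = (f \<cdot> h) \<boxplus> (g \<cdot> h)"

definition is_mono :: "('o, 'm) precat \<Rightarrow> 'm \<Rightarrow> bool" where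
  "is_mono C f \<longleftrightarrow> f \<in> Mor C \<and>
     (\<forall>A. \<forall>g\<in>Hom C A (Dom C f). \<forall>h\<in>Hom C A (Dom C f).
        f \<cdot>\<^bsub>C\<^esub> g = f \<cdot>\<^bsub>C\<^esub> h \<longrightarrow> g = h)"

definition is_epi :: "('o, 'm) precat \<Rightarrow> 'm \<Rightarrow> bool" where
  "is_epi C f \<longleftrightarrow> f \<in> Mor C \<and>
     (\<forall>B. \<forall>g\<in>Hom C (Cod C f) B. \<forall>h\<in>Hom C (Cod C f) B.
        g \<cdot>\<^bsub>C\<^esub> f = h \<cdot>\<^bsub>C\<^esub> f \<longrightarrow> g = h)"

definition is_iso :: "('o, 'm) precat \<Rightarrow> 'm \<Rightarrow> bool" where
  "is_iso C f \<longleftrightarrow> f \<in> Mor C \<and>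
     (\<exists>g\<in>Hom C (Cod C f) (Dom C f).
        g \<cdot>\<^bsub>C\<^esub> f = Id C (Dom C f) \<and> f \<cdot>\<^bsub>C\<^esub> g = Id C (Cod C f))"

definition isomorphic :: "('o, 'm) precat \<Rightarrow> 'o \<Rightarrow> 'o \<Rightarrow> bool" where
  "isomorphic C A B \<longleftrightarrow> (\<exists>f\<in>Hom C A B. is_iso C f)"

definition is_zero_object :: "('o, 'm) precat \<Rightarrow> 'o \<Rightarrow> bool" where
  "is_zero_object C Z \<longleftrightarrow> Z \<in> Obj C \<and>
     (\<forall>A\<in>Obj C. (\<exists>!f. f \<in> Hom C Z A) \<and> (\<exists>!f. f \<in> Hom C A Z))"

definition is_biproduct ::
  "('o, 'm) precat \<Rightarrow> 'o \<Rightarrow> 'o \<Rightarrow> 'o \<Rightarrow> 'm \<Rightarrow> 'm \<Rightarrow> 'm \<Rightarrow> 'm \<Rightarrow> bool" where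
  "is_biproduct C A B S \<iota>\<^sub>1 \<iota>\<^sub>2 \<pi>\<^sub>1 \<pi>\<^sub>2 \<longleftrightarrow>
     \<iota>\<^sub>1 \<in> Hom C A S \<and> \<iota>\<^sub>2 \<in> Hom C B S \<and> \<pi>\<^sub>1 \<in> Hom C S A \<and> \<pi>\<^sub>2 \<in> Hom C S B \<and>
     \<pi>\<^sub>1 \<cdot>\<^bsub>C\<^esub> \<iota>\<^sub>1 = Id C A \<and> \<pi>\<^sub>2 \<cdot>\<^bsub>C\<^esub> \<iota>\<^sub>2 = Id C B \<and>
     \<pi>\<^sub>1 \<cdot>\<^bsub>C\<^esub> \<iota>\<^sub>2 = Zer C B A \<and> \<pi>\<^sub>2 \<cdot>\<^bsub>C\<^esub> \<iota>\<^sub>1 = Zer C A B \<and>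
     (\<iota>\<^sub>1 \<cdot>\<^bsub>C\<^esub> \<pi>\<^sub>1) \<boxplus>\<^bsub>C\<^esub> (\<iota>\<^sub>2 \<cdot>\<^bsub>C\<^esub> \<pi>\<^sub>2) = Id C S"

definition is_direct_sum :: "('o, 'm) precat \<Rightarrow> 'o \<Rightarrow> 'o \<Rightarrow> 'o \<Rightarrow> bool" where
  "is_direct_sum C A B S \<longleftrightarrow> (\<exists>\<iota>\<^sub>1 \<iota>\<^sub>2 \<pi>\<^sub>1 \<pi>\<^sub>2. is_biproduct C A B S \<iota>\<^sub>1 \<iota>\<^sub>2 \<pi>\<^sub>1 \<pi>\<^sub>2)"

definition is_kernel :: "('o, 'm) precat \<Rightarrow> 'm \<Rightarrow> 'm \<Rightarrow> bool" where
  "is_kernel C k f \<longleftrightarrow> k \<in> Mor C \<and> f \<in> Mor C \<and> Cod C k = Dom C f \<and>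
     f \<cdot>\<^bsub>C\<^esub> k = Zer C (Dom C k) (Cod C f) \<and>
     (\<forall>A. \<forall>g\<in>Hom C A (Dom C f). f \<cdot>\<^bsub>C\<^esub> g = Zer C A (Cod C f) \<longrightarrow>
        (\<exists>!h. h \<in> Hom C A (Dom C k) \<and> k \<cdot>\<^bsub>C\<^esub> h = g))"

definition is_cokernel :: "('o, 'm) precat \<Rightarrow> 'm \<Rightarrow> 'm \<Rightarrow> bool" where
  "is_cokernel C c f \<longleftrightarrow> c \<in> Mor C \<and> f \<in> Mor C \<and> Dom C c = Cod C f \<and>
     c \<cdot>\<^bsub>C\<^esub> f = Zer C (Dom C f) (Cod C c) \<and>
     (\<forall>B. \<forall>g\<in>Hom C (Cod C f) B. g \<cdot>\<^bsub>C\<^esub> f = Zer C (Dom C f) B \<longrightarrow>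
        (\<exists>!h. h \<in> Hom C (Cod C c) B \<and> h \<cdot>\<^bsub>C\<^esub> c = g))"

locale abelian_category = preadditive_category +
  assumes zero_object: "\<exists>Z. is_zero_object C Z"
    and direct_sums: "\<lbrakk>A \<in> Obj C; B \<in> Obj C\<rbrakk> \<Longrightarrow> \<exists>S. is_direct_sum C A B S"
    and kernels: "f \<in> Mor C \<Longrightarrow> \<exists>k. is_kernel C k f"
    and cokernels: "f \<in> Mor C \<Longrightarrow> \<exists>c. is_cokernel C c f"
    and mono_normal: "is_mono C f \<Longrightarrow> \<exists>g. is_kernel C f g"
    and epi_normal: "is_epi C f \<Longrightarrow> \<exists>g. is_cokernel C f g"

text \<open>The objects \<open>Ker f\<close> and \<open>Coker f\<close>, well defined up to isomorphism.\<close>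

definition Ker_obj :: "('o, 'm) precat \<Rightarrow> 'm \<Rightarrow> 'o" where
  "Ker_obj C f = Dom C (SOME k. is_kernel C k f)"

definition Coker_obj :: "('o, 'm) precat \<Rightarrow> 'm \<Rightarrow> 'o" where
  "Coker_obj C f = Cod C (SOME c. is_cokernel C c f)"

text \<open>Full subcategories are represented by their sets of objects.  The word
  \<open>subcategory\<close> means a full additive subcategory closed under isomorphisms and
  direct summands.\<close>

definition subcategory :: "('o, 'm) precat \<Rightarrow> 'o set \<Rightarrow> bool" where
  "subcategory C U \<longleftrightarrow> U \<subseteq> Obj C \<and>
     (\<forall>Z. is_zero_object C Z \<longrightarrow> Z \<in> U) \<and>
     (\<forall>A\<in>U. \<forall>B\<in>U. \<forall>S. is_direct_sum C A B S \<longrightarrow> S \<in> U) \<and>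
     (\<forall>A\<in>U. \<forall>B. isomorphic C A B \<longrightarrow> B \<in> U) \<and>
     (\<forall>A B. \<forall>S\<in>U. is_direct_sum C A B S \<longrightarrow> A \<in> U)"


section \<open>Exact structures\<close>

text \<open>A class of short exact sequences \<open>0 \<rightarrow> L \<rightarrow> M \<rightarrow> N \<rightarrow> 0\<close> is a set of pairs
  \<open>(i, p)\<close> with \<open>i : L \<rightarrow> M\<close> and \<open>p : M \<rightarrow> N\<close>.  In an abelian category the kernel-cokernel
  pairs are exactly the short exact sequences.\<close>

definition kernel_cokernel_pairs :: "('o, 'm) precat \<Rightarrow> ('m \<times> 'm) set" where
  "kernel_cokernel_pairs C = {(i, p). is_kernel C i p \<and> is_cokernel C p i}"

abbreviation short_exact_sequences :: "('o, 'm) precat \<Rightarrow> ('m \<times> 'm) set" where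
  "short_exact_sequences \<equiv> kernel_cokernel_pairs"

definition admissible_monic :: "('m \<times> 'm) set \<Rightarrow> 'm \<Rightarrow> bool" where
  "admissible_monic \<E> i \<longleftrightarrow> (\<exists>p. (i, p) \<in> \<E>)"

definition admissible_epic :: "('m \<times> 'm) set \<Rightarrow> 'm \<Rightarrow> bool" where
  "admissible_epic \<E> p \<longleftrightarrow> (\<exists>i. (i, p) \<in> \<E>)"

definition iso_pairs :: "('o, 'm) precat \<Rightarrow> 'm \<times> 'm \<Rightarrow> 'm \<times> 'm \<Rightarrow> bool" where
  "iso_pairs C = (\<lambda>(i, p) (i', p'). \<exists>a b c.
     a \<in> Hom C (Dom C i) (Dom C i') \<and> is_iso C a \<and>
     b \<in> Hom C (Cod C i) (Cod C i') \<and> is_iso C b \<and>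
     c \<in> Hom C (Cod C p) (Cod C p') \<and> is_iso C c \<and>
     b \<cdot>\<^bsub>C\<^esub> i = i' \<cdot>\<^bsub>C\<^esub> a \<and> c \<cdot>\<^bsub>C\<^esub> p = p' \<cdot>\<^bsub>C\<^esub> b)"

text \<open>\<open>(i', f')\<close> is a push-out of \<open>(i, f)\<close>, with \<open>i'\<close> parallel to \<open>i\<close> and \<open>f'\<close> parallel
  to \<open>f\<close>, i.e. \<open>f' \<cdot> i = i' \<cdot> f\<close>; dually for pull-backs.\<close>

definition is_pushout :: "('o, 'm) precat \<Rightarrow> 'm \<Rightarrow> 'm \<Rightarrow> 'm \<Rightarrow> 'm \<Rightarrow> bool" where
  "is_pushout C i f i' f' \<longleftrightarrow>
     {i, f, i', f'} \<subseteq> Mor C \<and>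
     Dom C i = Dom C f \<and> Dom C i' = Cod C f \<and> Dom C f' = Cod C i \<and> Cod C i' = Cod C f' \<and>
     f' \<cdot>\<^bsub>C\<^esub> i = i' \<cdot>\<^bsub>C\<^esub> f \<and>
     (\<forall>T. \<forall>u\<in>Hom C (Cod C f) T. \<forall>v\<in>Hom C (Cod C i) T. v \<cdot>\<^bsub>C\<^esub> i = u \<cdot>\<^bsub>C\<^esub> f \<longrightarrow>
        (\<exists>!h. h \<in> Hom C (Cod C i') T \<and> h \<cdot>\<^bsub>C\<^esub> i' = u \<and> h \<cdot>\<^bsub>C\<^esub> f' = v))"

definition is_pullback :: "('o, 'm) precat \<Rightarrow> 'm \<Rightarrow> 'm \<Rightarrow> 'm \<Rightarrow> 'm \<Rightarrow> bool" where
  "is_pullback C p f p' f' \<longleftrightarrow>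
     {p, f, p', f'} \<subseteq> Mor C \<and>
     Cod C p = Cod C f \<and> Cod C p' = Dom C f \<and> Cod C f' = Dom C p \<and> Dom C p' = Dom C f' \<and>
     p \<cdot>\<^bsub>C\<^esub> f' = f \<cdot>\<^bsub>C\<^esub> p' \<and>
     (\<forall>T. \<forall>u\<in>Hom C T (Dom C f). \<forall>v\<in>Hom C T (Dom C p). p \<cdot>\<^bsub>C\<^esub> v = f \<cdot>\<^bsub>C\<^esub> u \<longrightarrow>
        (\<exists>!h. h \<in> Hom C T (Dom C p') \<and> p' \<cdot>\<^bsub>C\<^esub> h = u \<and> f' \<cdot>\<^bsub>C\<^esub> h = v))"

definition exact_structure :: "('o, 'm) precat \<Rightarrow> ('m \<times> 'm) set \<Rightarrow> bool" where
  "exact_structure C \<E> \<longleftrightarrow>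
     \<E> \<subseteq> kernel_cokernel_pairs C \<and>
     (\<forall>i p i' p'. (i, p) \<in> \<E> \<and> i' \<in> Mor C \<and> p' \<in> Mor C \<and> Cod C i' = Dom C p' \<and>
        iso_pairs C (i, p) (i', p') \<longrightarrow> (i', p') \<in> \<E>) \<and>
     (\<forall>A\<in>Obj C. admissible_monic \<E> (Id C A) \<and> admissible_epic \<E> (Id C A)) \<and>
     (\<forall>i j. admissible_monic \<E> i \<and> admissible_monic \<E> j \<and> Cod C i = Dom C j \<longrightarrow>
        admissible_monic \<E> (j \<cdot>\<^bsub>C\<^esub> i)) \<and>
     (\<forall>p q. admissible_epic \<E> p \<and> admissible_epic \<E> q \<and> Cod C p = Dom C q \<longrightarrow>
        admissible_epic \<E> (q \<cdot>\<^bsub>C\<^esub> p)) \<and>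
     (\<forall>i f. admissible_monic \<E> i \<and> f \<in> Mor C \<and> Dom C f = Dom C i \<longrightarrow>
        (\<exists>i' f'. is_pushout C i f i' f') \<and>
        (\<forall>i' f'. is_pushout C i f i' f' \<longrightarrow> admissible_monic \<E> i')) \<and>
     (\<forall>p f. admissible_epic \<E> p \<and> f \<in> Mor C \<and> Cod C f = Cod C p \<longrightarrow>
        (\<exists>p' f'. is_pullback C p f p' f') \<and>
        (\<forall>p' f'. is_pullback C p f p' f' \<longrightarrow> admissible_epic \<E> p'))"

text \<open>For \<open>\<E> = short_exact_sequences C\<close> these are the projective and the injective objects.\<close>

definition projectives :: "('o, 'm) precat \<Rightarrow> ('m \<times> 'm) set \<Rightarrow> 'o set" where
  "projectives C \<E> = {P \<in> Obj C. \<forall>p. admissible_epic \<E> p \<longrightarrow>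
     (\<forall>f\<in>Hom C P (Cod C p). \<exists>g\<in>Hom C P (Dom C p). p \<cdot>\<^bsub>C\<^esub> g = f)}"

definition injectives :: "('o, 'm) precat \<Rightarrow> ('m \<times> 'm) set \<Rightarrow> 'o set" where
  "injectives C \<E> = {I \<in> Obj C. \<forall>i. admissible_monic \<E> i \<longrightarrow>
     (\<forall>f\<in>Hom C (Dom C i) I. \<exists>g\<in>Hom C (Cod C i) I. g \<cdot>\<^bsub>C\<^esub> i = f)}"

definition enough_projectives :: "('o, 'm) precat \<Rightarrow> ('m \<times> 'm) set \<Rightarrow> bool" where
  "enough_projectives C \<E> \<longleftrightarrow>
     (\<forall>M\<in>Obj C. \<exists>p. admissible_epic \<E> p \<and> Dom C p \<in> projectives C \<E> \<and> Cod C p = M)"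

definition enough_injectives :: "('o, 'm) precat \<Rightarrow> ('m \<times> 'm) set \<Rightarrow> bool" where
  "enough_injectives C \<E> \<longleftrightarrow>
     (\<forall>M\<in>Obj C. \<exists>i. admissible_monic \<E> i \<and> Cod C i \<in> injectives C \<E> \<and> Dom C i = M)"


section \<open>Relative Ext groups\<close>

text \<open>A projective resolution of \<open>M\<close> is spliced from conflations
  \<open>r n = (K (n+1) \<rightarrow> P n, P n \<rightarrow> K n)\<close> with \<open>K 0 = M\<close> and \<open>P n\<close> projective.\<close>

definition projective_resolution ::
  "('o, 'm) precat \<Rightarrow> ('m \<times> 'm) set \<Rightarrow> 'o \<Rightarrow> (nat \<Rightarrow> 'm \<times> 'm) \<Rightarrow> bool" where
  "projective_resolution C \<E> M r \<longleftrightarrow>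
     (\<forall>n. r n \<in> \<E> \<and> Dom C (snd (r n)) \<in> projectives C \<E>) \<and>
     Cod C (snd (r 0)) = M \<and>
     (\<forall>n. Cod C (snd (r (Suc n))) = Dom C (fst (r n)))"

definition res_obj :: "('o, 'm) precat \<Rightarrow> (nat \<Rightarrow> 'm \<times> 'm) \<Rightarrow> nat \<Rightarrow> 'o" where
  "res_obj C r n = Dom C (snd (r n))"

text \<open>The differential \<open>P n \<rightarrow> P (n-1)\<close>, for \<open>n \<ge> 1\<close>.\<close>

definition res_diff :: "('o, 'm) precat \<Rightarrow> (nat \<Rightarrow> 'm \<times> 'm) \<Rightarrow> nat \<Rightarrow> 'm" where
  "res_diff C r n = fst (r (n - 1)) \<cdot>\<^bsub>C\<^esub> snd (r n)"

text \<open>The cohomology in degree \<open>n \<ge> 1\<close> of the complex \<open>Hom(P, N)\<close>.\<close>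

definition cocycles :: "('o, 'm) precat \<Rightarrow> (nat \<Rightarrow> 'm \<times> 'm) \<Rightarrow> nat \<Rightarrow> 'o \<Rightarrow> 'm set" where
  "cocycles C r n N = {f \<in> Hom C (res_obj C r n) N.
     f \<cdot>\<^bsub>C\<^esub> res_diff C r (n + 1) = Zer C (res_obj C r (n + 1)) N}"

definition coboundaries :: "('o, 'm) precat \<Rightarrow> (nat \<Rightarrow> 'm \<times> 'm) \<Rightarrow> nat \<Rightarrow> 'o \<Rightarrow> 'm set" where
  "coboundaries C r n N = (\<lambda>g. g \<cdot>\<^bsub>C\<^esub> res_diff C r n) ` Hom C (res_obj C r (n - 1)) N"

definition res_cohomology ::
  "('o, 'm) precat \<Rightarrow> (nat \<Rightarrow> 'm \<times> 'm) \<Rightarrow> nat \<Rightarrow> 'o \<Rightarrow> 'm set monoid" where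
  "res_cohomology C r n N =
     (Hom_group C (res_obj C r n) N)\<lparr>carrier := cocycles C r n N\<rparr> Mod coboundaries C r n N"

text \<open>For \<open>n \<ge> 1\<close>; by the comparison theorem the choice of the resolution is immaterial
  up to isomorphism.\<close>

definition rel_Ext ::
  "('o, 'm) precat \<Rightarrow> ('m \<times> 'm) set \<Rightarrow> nat \<Rightarrow> 'o \<Rightarrow> 'o \<Rightarrow> 'm set monoid" where
  "rel_Ext C \<E> n M N = res_cohomology C (SOME r. projective_resolution C \<E> M r) n N"

definition rel_Ext1_vanishes ::
  "('o, 'm) precat \<Rightarrow> ('m \<times> 'm) set \<Rightarrow> 'o \<Rightarrow> 'o \<Rightarrow> bool" where
  "rel_Ext1_vanishes C \<E> M N \<longleftrightarrow> trivial_group (rel_Ext C \<E> 1 M N)"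


section \<open>The absolute \<open>Ext\<^sup>1\<close>\<close>

text \<open>No projectives or injectives are available for the absolute theory, so
  \<open>Ext\<^sup>1(M, N)\<close> consists of the equivalence classes of extensions
  \<open>0 \<rightarrow> N \<rightarrow> E \<rightarrow> M \<rightarrow> 0\<close>.  A morphism of such extensions that is the identity at both ends
  is an isomorphism by the five lemma.  The zero element is the class of
  \<open>0 \<rightarrow> N \<rightarrow> N \<oplus> M \<rightarrow> M \<rightarrow> 0\<close>; the Baer sum plays no role for the vanishing of \<open>Ext\<^sup>1\<close>.\<close>

definition extensions :: "('o, 'm) precat \<Rightarrow> 'o \<Rightarrow> 'o \<Rightarrow> ('m \<times> 'm) set" where
  "extensions C M N =
     {(i, p) \<in> short_exact_sequences C. Dom C i = N \<and> Cod C p = M}"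

definition extension_equiv ::
  "('o, 'm) precat \<Rightarrow> 'o \<Rightarrow> 'o \<Rightarrow> (('m \<times> 'm) \<times> ('m \<times> 'm)) set" where
  "extension_equiv C M N =
     {((i, p), (i', p')). (i, p) \<in> extensions C M N \<and> (i', p') \<in> extensions C M N \<and>
        (\<exists>\<phi>\<in>Hom C (Cod C i) (Cod C i'). is_iso C \<phi> \<and>
           \<phi> \<cdot>\<^bsub>C\<^esub> i = i' \<and> p' \<cdot>\<^bsub>C\<^esub> \<phi> = p)}"

definition Ext1 :: "('o, 'm) precat \<Rightarrow> 'o \<Rightarrow> 'o \<Rightarrow> ('m \<times> 'm) set set" where
  "Ext1 C M N = extensions C M N // extension_equiv C M N"

definition Ext1_zero :: "('o, 'm) precat \<Rightarrow> 'o \<Rightarrow> 'o \<Rightarrow> ('m \<times> 'm) set" where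
  "Ext1_zero C M N = extension_equiv C M N ``
     {(\<iota>\<^sub>1, \<pi>\<^sub>2) | \<iota>\<^sub>1 \<pi>\<^sub>2. \<exists>S \<iota>\<^sub>2 \<pi>\<^sub>1. is_biproduct C N M S \<iota>\<^sub>1 \<iota>\<^sub>2 \<pi>\<^sub>1 \<pi>\<^sub>2}"

definition Ext1_vanishes :: "('o, 'm) precat \<Rightarrow> 'o \<Rightarrow> 'o \<Rightarrow> bool" where
  "Ext1_vanishes C M N \<longleftrightarrow> Ext1 C M N = {Ext1_zero C M N}"


section \<open>Cotorsion pairs\<close>

text \<open>The absolute and the relative notions are instances of one definition: \<open>\<E>\<close> is the
  class of short exact sequences in question and \<open>van M N\<close> says that the corresponding
  \<open>Ext\<^sup>1(M, N)\<close> is zero.\<close>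

definition right_perp :: "('o, 'm) precat \<Rightarrow> ('o \<Rightarrow> 'o \<Rightarrow> bool) \<Rightarrow> 'o set \<Rightarrow> 'o set" where
  "right_perp C van U = {N \<in> Obj C. \<forall>M\<in>U. van M N}"

definition left_perp :: "('o, 'm) precat \<Rightarrow> ('o \<Rightarrow> 'o \<Rightarrow> bool) \<Rightarrow> 'o set \<Rightarrow> 'o set" where
  "left_perp C van V = {M \<in> Obj C. \<forall>N\<in>V. van M N}"

definition is_cotorsion_pair ::
  "('o, 'm) precat \<Rightarrow> ('o \<Rightarrow> 'o \<Rightarrow> bool) \<Rightarrow> 'o set \<Rightarrow> 'o set \<Rightarrow> bool" where
  "is_cotorsion_pair C van U V \<longleftrightarrow> subcategory C U \<and> subcategory C V \<and>
     U = left_perp C van V \<and> V = right_perp C van U"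

definition is_complete ::
  "('o, 'm) precat \<Rightarrow> ('m \<times> 'm) set \<Rightarrow> 'o set \<Rightarrow> 'o set \<Rightarrow> bool" where
  "is_complete C \<E> U V \<longleftrightarrow> (\<forall>M\<in>Obj C.
     (\<exists>i p. (i, p) \<in> \<E> \<and> Dom C i \<in> V \<and> Cod C i \<in> U \<and> Cod C p = M) \<and>
     (\<exists>i p. (i, p) \<in> \<E> \<and> Dom C i = M \<and> Cod C i \<in> V \<and> Cod C p \<in> U))"

definition is_resolving ::
  "('o, 'm) precat \<Rightarrow> ('m \<times> 'm) set \<Rightarrow> 'o set \<Rightarrow> bool" where
  "is_resolving C \<E> U \<longleftrightarrow> projectives C \<E> \<subseteq> U \<and>
     (\<forall>i p. (i, p) \<in> \<E> \<and> Dom C i \<in> U \<and> Cod C p \<in> U \<longrightarrow> Cod C i \<in> U) \<and>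
     (\<forall>i p. (i, p) \<in> \<E> \<and> Cod C i \<in> U \<and> Cod C p \<in> U \<longrightarrow> Dom C i \<in> U)"

definition complete_hereditary_cotorsion_pair ::
  "('o, 'm) precat \<Rightarrow> 'o set \<Rightarrow> 'o set \<Rightarrow> bool" where
  "complete_hereditary_cotorsion_pair C U V \<longleftrightarrow>
     is_cotorsion_pair C (Ext1_vanishes C) U V \<and>
     is_complete C (short_exact_sequences C) U V \<and>
     is_resolving C (short_exact_sequences C) U"

definition complete_hereditary_rel_cotorsion_pair ::
  "('o, 'm) precat \<Rightarrow> ('m \<times> 'm) set \<Rightarrow> 'o set \<Rightarrow> 'o set \<Rightarrow> bool" where
  "complete_hereditary_rel_cotorsion_pair C \<E> U V \<longleftrightarrow>
     is_cotorsion_pair C (rel_Ext1_vanishes C \<E>) U V \<and>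
     is_complete C \<E> U V \<and>
     is_resolving C \<E> U"

abbreviation rel_right_perp :: "('o, 'm) precat \<Rightarrow> ('m \<times> 'm) set \<Rightarrow> 'o set \<Rightarrow> 'o set" where
  "rel_right_perp C \<E> \<equiv> right_perp C (rel_Ext1_vanishes C \<E>)"

abbreviation rel_left_perp :: "('o, 'm) precat \<Rightarrow> ('m \<times> 'm) set \<Rightarrow> 'o set \<Rightarrow> 'o set" where
  "rel_left_perp C \<E> \<equiv> left_perp C (rel_Ext1_vanishes C \<E>)"


section \<open>Precovers and preenvelopes\<close>

definition is_precover :: "('o, 'm) precat \<Rightarrow> 'o set \<Rightarrow> 'o \<Rightarrow> 'm \<Rightarrow> bool" where
  "is_precover C U A p \<longleftrightarrow> p \<in> Mor C \<and> Dom C p \<in> U \<and> Cod C p = A \<and>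
     (\<forall>U'\<in>U. \<forall>f\<in>Hom C U' A. \<exists>g\<in>Hom C U' (Dom C p). p \<cdot>\<^bsub>C\<^esub> g = f)"

definition is_preenvelope :: "('o, 'm) precat \<Rightarrow> 'o set \<Rightarrow> 'o \<Rightarrow> 'm \<Rightarrow> bool" where
  "is_preenvelope C V A j \<longleftrightarrow> j \<in> Mor C \<and> Dom C j = A \<and> Cod C j \<in> V \<and>
     (\<forall>V'\<in>V. \<forall>f\<in>Hom C A V'. \<exists>g\<in>Hom C (Cod C j) V'. g \<cdot>\<^bsub>C\<^esub> j = f)"

end

theory Submission
  imports Defs
begin

text \<open>For an object \<open>A\<close> choose a conflation \<open>A \<rightarrow> I \<rightarrow> C\<close> with \<open>I\<close> relatively injective and a
  short exact sequence \<open>Y \<rightarrow> X \<rightarrow> C\<close> from the completeness of \<open>(\<X>, \<Y>)\<close>.  Their pullback \<open>Q\<close> sits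
  in a conflation \<open>A \<rightarrow> Q \<rightarrow> X\<close> and a short exact sequence \<open>Y \<rightarrow> Q \<rightarrow> I\<close>.  Although the latter
  need not be a conflation, \<open>Q\<close> is relatively right orthogonal to \<open>\<X>\<close>: for a conflation
  \<open>K \<rightarrow> P \<rightarrow> X'\<close> with \<open>P\<close> relatively projective and \<open>X'\<close> in \<open>\<X>\<close>, a map \<open>K \<rightarrow> Q\<close> extends to
  \<open>P\<close> modulo \<open>Y\<close>, because \<open>I\<close> is relatively injective and \<open>P\<close> is in \<open>\<X>\<close>, and then the error
  \<open>K \<rightarrow> Y\<close> extends to \<open>P\<close> as well.  Salce's trick gives the other half of completeness.
  The second part is the first one in the opposite category, except that \<open>\<Y>\<close> must be shown
  to be closed under cokernels of monomorphisms, and the left orthogonal of \<open>\<Y>\<close> under kernels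
  of admissible epics.\<close>


section \<open>The opposite category\<close>

text \<open>An involution under which the simp rules below turn every notion into its dual. Lemmas
  of a locale stable under it therefore dualize by instantiation and
  \<open>simplified\<close>.\<close>

definition opposite :: "('o, 'm) precat \<Rightarrow> ('o, 'm) precat" where
  "opposite C = \<lparr>Obj = Obj C, Mor = Mor C, Dom = Cod C, Cod = Dom C, Id = Id C,
     Comp = (\<lambda>f g. g \<cdot>\<^bsub>C\<^esub> f), Add = Add C, Zer = (\<lambda>A B. Zer C B A)\<rparr>"

lemma opposite_sel [simp]:
  "Obj (opposite C) = Obj C" "Mor (opposite C) = Mor C"
  "Dom (opposite C) = Cod C" "Cod (opposite C) = Dom C" "Id (opposite C) = Id C"
  "f \<cdot>\<^bsub>opposite C\<^esub> g = g \<cdot>\<^bsub>C\<^esub> f" "f \<boxplus>\<^bsub>opposite C\<^esub> g = f \<boxplus>\<^bsub>C\<^esub> g"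
  "Zer (opposite C) A B = Zer C B A"
  by (simp_all add: opposite_def)

lemma opposite_opposite [simp]: "opposite (opposite C) = C"
  by (cases C) (simp add: opposite_def)

lemma Hom_opposite [simp]: "Hom (opposite C) A B = Hom C B A"
  by (auto simp: Hom_def)

lemma Hom_group_opposite [simp]: "Hom_group (opposite C) A B = Hom_group C B A"
  by (simp add: Hom_group_def opposite_def) (simp add: Hom_def conj_ac)

lemma is_mono_opposite [simp]: "is_mono (opposite C) f = is_epi C f"
  by (simp add: is_mono_def is_epi_def)

lemma is_epi_opposite [simp]: "is_epi (opposite C) f = is_mono C f"
  by (simp add: is_mono_def is_epi_def)

lemma is_iso_opposite [simp]: "is_iso (opposite C) f = is_iso C f"
  by (auto simp: is_iso_def)

lemma is_kernel_opposite [simp]: "is_kernel (opposite C) k f = is_cokernel C k f"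
  by (auto simp: is_kernel_def is_cokernel_def)

lemma is_cokernel_opposite [simp]: "is_cokernel (opposite C) k f = is_kernel C k f"
  by (auto simp: is_kernel_def is_cokernel_def)

lemma is_zero_object_opposite [simp]: "is_zero_object (opposite C) Z = is_zero_object C Z"
  by (auto simp: is_zero_object_def)

lemma is_biproduct_opposite [simp]:
  "is_biproduct (opposite C) A B S i\<^sub>1 i\<^sub>2 p\<^sub>1 p\<^sub>2 = is_biproduct C A B S p\<^sub>1 p\<^sub>2 i\<^sub>1 i\<^sub>2"
  by (auto simp: is_biproduct_def)

lemma is_direct_sum_opposite [simp]: "is_direct_sum (opposite C) = is_direct_sum C"
  by (intro ext) (simp add: is_direct_sum_def, blast)

lemma is_pushout_opposite [simp]: "is_pushout (opposite C) = is_pullback C"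
  by (intro ext) (simp add: is_pushout_def is_pullback_def)

lemma is_pullback_opposite [simp]: "is_pullback (opposite C) = is_pushout C"
  by (intro ext) (simp add: is_pushout_def is_pullback_def)

text \<open>Reversing arrows exchanges the members of a pair, so the dual of a class of pairs is its
  converse relation.\<close>

lemma kernel_cokernel_pairs_opposite [simp]:
  "kernel_cokernel_pairs (opposite C) = (kernel_cokernel_pairs C)\<inverse>"
  by (auto simp: kernel_cokernel_pairs_def)

lemma admissible_converse [simp]:
  "admissible_monic (E\<inverse>) = admissible_epic E" "admissible_epic (E\<inverse>) = admissible_monic E"
  by (auto simp: admissible_monic_def admissible_epic_def)

lemma isomorphic_sym: "isomorphic C A B \<Longrightarrow> isomorphic C B A"
  by (auto simp: isomorphic_def is_iso_def Hom_def)

lemma isomorphic_opposite [simp]: "isomorphic (opposite C) = isomorphic C"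
proof (intro ext)
  show "isomorphic (opposite C) A B = isomorphic C A B" for A B
    using isomorphic_sym[of C A B] isomorphic_sym[of C B A] by (auto simp: isomorphic_def)
qed

lemma subcategory_opposite [simp]: "subcategory (opposite C) U = subcategory C U"
  by (simp add: subcategory_def)

lemma projectives_opposite [simp]: "projectives (opposite C) (E\<inverse>) = injectives C E"
  by (simp add: projectives_def injectives_def)

lemma injectives_opposite [simp]: "injectives (opposite C) (E\<inverse>) = projectives C E"
  by (simp add: projectives_def injectives_def)

lemma enough_opposite [simp]:
  "enough_projectives (opposite C) (E\<inverse>) = enough_injectives C E"
  "enough_injectives (opposite C) (E\<inverse>) = enough_projectives C E"
  by (simp_all add: enough_projectives_def enough_injectives_def)

lemma Coker_obj_opposite [simp]: "Coker_obj (opposite C) f = Ker_obj C f"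
  by (simp add: Coker_obj_def Ker_obj_def)

lemma is_preenvelope_opposite [simp]: "is_preenvelope (opposite C) V A j = is_precover C V A j"
  by (auto simp: is_preenvelope_def is_precover_def)


section \<open>Universal properties and preadditive categories\<close>

text \<open>Names the objects of the square instead of using \<open>Dom\<close> and
  \<open>Cod\<close>, so that the universal property matches typing facts of the form
  \<open>f \<in> Hom C A B\<close>.\<close>

lemma is_pushout_iff:
  assumes "i \<in> Hom C L M" "f \<in> Hom C L L'" "i' \<in> Hom C L' Q" "f' \<in> Hom C M Q"
  shows "is_pushout C i f i' f' \<longleftrightarrow> f' \<cdot>\<^bsub>C\<^esub> i = i' \<cdot>\<^bsub>C\<^esub> f \<and>
     (\<forall>T. \<forall>u\<in>Hom C L' T. \<forall>v\<in>Hom C M T. v \<cdot>\<^bsub>C\<^esub> i = u \<cdot>\<^bsub>C\<^esub> f \<longrightarrow>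
        (\<exists>!h. h \<in> Hom C Q T \<and> h \<cdot>\<^bsub>C\<^esub> i' = u \<and> h \<cdot>\<^bsub>C\<^esub> f' = v))"
proof -
  have "{i, f, i', f'} \<subseteq> Mor C" "Dom C i = L" "Cod C i = M" "Dom C f = L" "Cod C f = L'"
    "Dom C i' = L'" "Cod C i' = Q" "Dom C f' = M" "Cod C f' = Q"
    using assms by (auto simp: Hom_def)
  then show ?thesis unfolding is_pushout_def by simp
qed

lemma is_pushout_Hom:
  assumes "is_pushout C i f i' f'" "i \<in> Hom C L M" "f \<in> Hom C L L'"
  shows "i' \<in> Hom C L' (Cod C i')" "f' \<in> Hom C M (Cod C i')"
proof -
  have "{i, f, i', f'} \<subseteq> Mor C" "Dom C i' = Cod C f" "Dom C f' = Cod C i" "Cod C i' = Cod C f'"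
    using assms(1) unfolding is_pushout_def by blast+
  with assms(2,3) show "i' \<in> Hom C L' (Cod C i')" "f' \<in> Hom C M (Cod C i')"
    by (simp_all add: Hom_def)
qed

lemma is_cokernel_iff:
  assumes "f \<in> Hom C L M" "c \<in> Hom C M N"
  shows "is_cokernel C c f \<longleftrightarrow> c \<cdot>\<^bsub>C\<^esub> f = Zer C L N \<and>
     (\<forall>B. \<forall>g\<in>Hom C M B. g \<cdot>\<^bsub>C\<^esub> f = Zer C L B \<longrightarrow>
        (\<exists>!h. h \<in> Hom C N B \<and> h \<cdot>\<^bsub>C\<^esub> c = g))"
proof -
  have "c \<in> Mor C" "f \<in> Mor C" "Dom C f = L" "Cod C f = M" "Dom C c = M" "Cod C c = N"
    using assms by (auto simp: Hom_def)
  then show ?thesis unfolding is_cokernel_def by simp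
qed

lemma is_kernel_iff:
  assumes "k \<in> Hom C K M" "f \<in> Hom C M N"
  shows "is_kernel C k f \<longleftrightarrow> f \<cdot>\<^bsub>C\<^esub> k = Zer C K N \<and>
     (\<forall>A. \<forall>g\<in>Hom C A M. f \<cdot>\<^bsub>C\<^esub> g = Zer C A N \<longrightarrow>
        (\<exists>!h. h \<in> Hom C A K \<and> k \<cdot>\<^bsub>C\<^esub> h = g))"
  using is_cokernel_iff[of f "opposite C" N M k K] assms by simp

lemma is_pushout_sym: "is_pushout C i f i' f' \<Longrightarrow> is_pushout C f i f' i'"
proof -
  assume a: "is_pushout C i f i' f'"
  then have ty: "{i, f, i', f'} \<subseteq> Mor C" "Dom C i = Dom C f" "Dom C i' = Cod C f"
      "Dom C f' = Cod C i" "Cod C i' = Cod C f'" "f' \<cdot>\<^bsub>C\<^esub> i = i' \<cdot>\<^bsub>C\<^esub> f"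
    unfolding is_pushout_def by blast+
  have "\<exists>!h. h \<in> Hom C (Cod C f') T \<and> h \<cdot>\<^bsub>C\<^esub> f' = u \<and> h \<cdot>\<^bsub>C\<^esub> i' = v"
    if "u \<in> Hom C (Cod C i) T" "v \<in> Hom C (Cod C f) T" "v \<cdot>\<^bsub>C\<^esub> f = u \<cdot>\<^bsub>C\<^esub> i" for T u v
  proof -
    have "\<exists>!h. h \<in> Hom C (Cod C i') T \<and> h \<cdot>\<^bsub>C\<^esub> i' = v \<and> h \<cdot>\<^bsub>C\<^esub> f' = u"
      using a that unfolding is_pushout_def by metis
    with ty(5) show ?thesis by metis
  qed
  with ty show ?thesis unfolding is_pushout_def by simp
qed

context category
begin

lemma cokernels_iso:
  assumes c: "is_cokernel C c f" and d: "is_cokernel C d f"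
  shows "\<exists>a\<in>Hom C (Cod C c) (Cod C d). is_iso C a \<and> a \<cdot> c = d"
proof -
  have f: "f \<in> Hom C (Dom C f) (Cod C f)" and cH: "c \<in> Hom C (Cod C f) (Cod C c)"
    and dH: "d \<in> Hom C (Cod C f) (Cod C d)"
    using c d unfolding is_cokernel_def Hom_def by auto
  note c' = c[unfolded is_cokernel_iff[OF f cH]] and d' = d[unfolded is_cokernel_iff[OF f dH]]
  obtain a where a: "a \<in> Hom C (Cod C c) (Cod C d)" "a \<cdot> c = d" using c' d' dH by blast
  obtain b where b: "b \<in> Hom C (Cod C d) (Cod C c)" "b \<cdot> d = c" using c' d' cH by blast
  have ob: "Cod C c \<in> Obj C" "Cod C d \<in> Obj C" using cH dH Cod_in_Obj by (auto simp: Hom_def)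
  have "b \<cdot> a \<in> Hom C (Cod C c) (Cod C c)" "(b \<cdot> a) \<cdot> c = c"
    using Comp_in_Hom[OF a(1) b(1)] Comp_assoc[OF cH a(1) b(1)] a(2) b(2) by simp_all
  then have "b \<cdot> a = Id C (Cod C c)" using c' cH Id_in_Hom[OF ob(1)] Id_Comp[OF cH] by blast
  moreover have "a \<cdot> b \<in> Hom C (Cod C d) (Cod C d)" "(a \<cdot> b) \<cdot> d = d"
    using Comp_in_Hom[OF b(1) a(1)] Comp_assoc[OF dH b(1) a(1)] a(2) b(2) by simp_all
  then have "a \<cdot> b = Id C (Cod C d)" using d' dH Id_in_Hom[OF ob(2)] Id_Comp[OF dH] by blast
  ultimately have "is_iso C a" using a b unfolding is_iso_def Hom_def by auto
  then show ?thesis using a by blast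
qed

end

section \<open>Addition and zero morphisms\<close>

context preadditive_category
begin

lemma Hom_Obj: assumes "f \<in> Hom C A B" shows "A \<in> Obj C" "B \<in> Obj C"
  using assms Dom_in_Obj Cod_in_Obj by (auto simp: Hom_def)

lemma Zer_in_Hom: "\<lbrakk>A \<in> Obj C; B \<in> Obj C\<rbrakk> \<Longrightarrow> Zer C A B \<in> Hom C A B"
  using comm_group.axioms(1)[OF Hom_comm_group] comm_monoid.axioms(1) monoid.one_closed
  by (fastforce simp: Hom_group_def)

lemma Add_in_Hom: assumes "f \<in> Hom C A B" "g \<in> Hom C A B" shows "f \<boxplus> g \<in> Hom C A B"
proof -
  interpret comm_group "Hom_group C A B" using Hom_Obj[OF assms(1)] by (rule Hom_comm_group)
  show ?thesis using m_closed assms by (simp add: Hom_group_def)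
qed

lemma Zer_Add: assumes "f \<in> Hom C A B" shows "Zer C A B \<boxplus> f = f" "f \<boxplus> Zer C A B = f"
proof -
  interpret comm_group "Hom_group C A B" using Hom_Obj[OF assms(1)] by (rule Hom_comm_group)
  show "Zer C A B \<boxplus> f = f" "f \<boxplus> Zer C A B = f"
    using l_one r_one assms by (simp_all add: Hom_group_def)
qed

lemma Add_idem_Zer: assumes "f \<in> Hom C A B" "f \<boxplus> f = f" shows "f = Zer C A B"
proof -
  interpret comm_group "Hom_group C A B" using Hom_Obj[OF assms(1)] by (rule Hom_comm_group)
  show ?thesis using r_cancel_one[of f f] assms by (simp add: Hom_group_def)
qed

text \<open>Distributivity makes the composite its own double, and only the neutral element of a
  group is idempotent.\<close>

lemma Comp_Zer:
  assumes "f \<in> Hom C B D" "A \<in> Obj C" shows "f \<cdot> Zer C A B = Zer C A D"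
proof -
  have z: "Zer C A B \<in> Hom C A B" using assms Hom_Obj Zer_in_Hom by blast
  then have "f \<cdot> Zer C A B \<boxplus> f \<cdot> Zer C A B = f \<cdot> Zer C A B"
    using Comp_Add[OF z z assms(1)] Zer_Add[OF z] by simp
  then show ?thesis using Add_idem_Zer Comp_in_Hom[OF z assms(1)] by blast
qed

lemma Zer_Comp:
  assumes "f \<in> Hom C A B" "D \<in> Obj C" shows "Zer C B D \<cdot> f = Zer C A D"
proof -
  have z: "Zer C B D \<in> Hom C B D" using assms Hom_Obj Zer_in_Hom by blast
  then have "Zer C B D \<cdot> f \<boxplus> Zer C B D \<cdot> f = Zer C B D \<cdot> f"
    using Add_Comp[OF assms(1) z z] Zer_Add[OF z] by simp
  then show ?thesis using Add_idem_Zer Comp_in_Hom[OF assms(1) z] by blast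
qed

text \<open>Replaces subtraction, for which \<open>precat\<close> has no symbol: \<open>d\<close> is
  \<open>f - g\<close>, and \<open>Add_right_cancel\<close> completes the arguments that use
  it.\<close>

lemma difference_exists:
  assumes "f \<in> Hom C A B" "g \<in> Hom C A B" shows "\<exists>d\<in>Hom C A B. d \<boxplus> g = f"
proof -
  interpret comm_group "Hom_group C A B" using Hom_Obj[OF assms(1)] by (rule Hom_comm_group)
  have c: "carrier (Hom_group C A B) = Hom C A B" by (simp add: Hom_group_def)
  have "\<exists>d\<in>carrier (Hom_group C A B). d \<otimes>\<^bsub>Hom_group C A B\<^esub> g = f"
    using assms unfolding c[symmetric]
    by (intro bexI[of _ "f \<otimes>\<^bsub>Hom_group C A B\<^esub> inv\<^bsub>Hom_group C A B\<^esub> g"]) (simp_all add: m_assoc)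
  then show ?thesis by (simp add: Hom_group_def)
qed

lemma Add_right_cancel:
  assumes "f \<in> Hom C A B" "g \<in> Hom C A B" "h \<in> Hom C A B"
  shows "f \<boxplus> h = g \<boxplus> h \<longleftrightarrow> f = g"
proof -
  interpret comm_group "Hom_group C A B" using Hom_Obj[OF assms(1)] by (rule Hom_comm_group)
  show ?thesis using right_cancel[of h f g] assms by (simp add: Hom_group_def)
qed

lemma Add_commute:
  assumes "f \<in> Hom C A B" "g \<in> Hom C A B" shows "f \<boxplus> g = g \<boxplus> f"
proof -
  interpret comm_group "Hom_group C A B" using Hom_Obj[OF assms(1)] by (rule Hom_comm_group)
  show ?thesis using m_comm assms by (simp add: Hom_group_def)
qed

lemma preadditive_category_opposite: "preadditive_category (opposite C)"
  unfolding preadditive_category_def preadditive_category_axioms_def category_def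
  by (auto simp: Hom_comm_group Comp_Add Add_Comp Dom_in_Obj Cod_in_Obj Id_in_Hom Comp_Id Id_Comp
      Comp_assoc intro: Comp_in_Hom)

text \<open>Exhibits the cocycles and coboundaries below as images of group homomorphisms, hence as
  subgroups.\<close>

lemma precomposition_group_hom:
  assumes d: "d \<in> Hom C A B" and N: "N \<in> Obj C"
  shows "group_hom (Hom_group C B N) (Hom_group C A N) (\<lambda>g. g \<cdot> d)"
proof -
  have "(\<lambda>g. g \<cdot> d) \<in> hom (Hom_group C B N) (Hom_group C A N)"
    using Comp_in_Hom[OF d] Add_Comp[OF d] by (auto simp: hom_def Hom_group_def)
  then show ?thesis
    using Hom_comm_group Hom_Obj[OF d] N comm_group.axioms(2)
    unfolding group_hom_def group_hom_axioms_def by blast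
qed

section \<open>Biproducts\<close>

lemma biproduct_Hom:
  assumes "is_biproduct C A B S a b x y"
  shows "a \<in> Hom C A S" "b \<in> Hom C B S" "x \<in> Hom C S A" "y \<in> Hom C S B"
    "x \<cdot> a = Id C A" "y \<cdot> b = Id C B" "x \<cdot> b = Zer C B A" "y \<cdot> a = Zer C A B"
    "a \<cdot> x \<boxplus> b \<cdot> y = Id C S"
  using assms unfolding is_biproduct_def by blast+

lemma biproduct_copair:
  assumes S: "is_biproduct C A B S a b x y" and u: "u \<in> Hom C A T" and v: "v \<in> Hom C B T"
  shows "u \<cdot> x \<boxplus> v \<cdot> y \<in> Hom C S T"
    "(u \<cdot> x \<boxplus> v \<cdot> y) \<cdot> a = u" "(u \<cdot> x \<boxplus> v \<cdot> y) \<cdot> b = v"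
proof -
  note S = biproduct_Hom[OF S]
  have ux: "u \<cdot> x \<in> Hom C S T" and vy: "v \<cdot> y \<in> Hom C S T" using S u v Comp_in_Hom by blast+
  then show "u \<cdot> x \<boxplus> v \<cdot> y \<in> Hom C S T" by (rule Add_in_Hom)
  note ob = Hom_Obj[OF u] Hom_Obj[OF v]
  show "(u \<cdot> x \<boxplus> v \<cdot> y) \<cdot> a = u"
    using Add_Comp[OF S(1) ux vy] Comp_assoc[OF S(1,3) u] Comp_assoc[OF S(1,4) v] S(5,8)
      Comp_Id[OF u] Comp_Zer[OF v] Zer_Add[OF u] ob by simp
  show "(u \<cdot> x \<boxplus> v \<cdot> y) \<cdot> b = v"
    using Add_Comp[OF S(2) ux vy] Comp_assoc[OF S(2,3) u] Comp_assoc[OF S(2,4) v] S(6,7)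
      Comp_Id[OF v] Comp_Zer[OF u] Zer_Add[OF v] ob by simp
qed

lemma biproduct_copair_unique:
  assumes S: "is_biproduct C A B S a b x y" and h: "h \<in> Hom C S T"
  shows "(h \<cdot> a) \<cdot> x \<boxplus> (h \<cdot> b) \<cdot> y = h"
proof -
  note S = biproduct_Hom[OF S]
  have "a \<cdot> x \<in> Hom C S S" "b \<cdot> y \<in> Hom C S S" using S Comp_in_Hom by blast+
  from Comp_Add[OF this h] show ?thesis
    using Comp_assoc[OF S(3,1) h] Comp_assoc[OF S(4,2) h] S(9) Comp_Id[OF h] by simp
qed

text \<open>A morphism \<open>g\<close> that kills \<open>a\<close> equals
  \<open>(g \<cdot> b) \<cdot> y\<close> by its decomposition into components, and \<open>b\<close>
  is a section of \<open>y\<close>, which makes the factor unique.\<close>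

lemma biproduct_cokernel: assumes S: "is_biproduct C A B S a b x y" shows "is_cokernel C y a"
proof -
  note SH = biproduct_Hom[OF S]
  show ?thesis unfolding is_cokernel_iff[OF SH(1,4)]
  proof (intro conjI allI ballI impI SH(8))
    fix T g assume g: "g \<in> Hom C S T" and z: "g \<cdot> a = Zer C A T"
    have gb: "g \<cdot> b \<in> Hom C B T" using SH(2) g by (rule Comp_in_Hom)
    have "(g \<cdot> b) \<cdot> y \<in> Hom C S T" using SH(4) gb by (rule Comp_in_Hom)
    then have "(g \<cdot> b) \<cdot> y = g"
      using biproduct_copair_unique[OF S g] z Zer_Comp[OF SH(3)] Zer_Add Hom_Obj[OF g] by simp
    moreover have "h = g \<cdot> b" if "h \<in> Hom C B T" "h \<cdot> y = g" for h
      using Comp_assoc[OF SH(2,4) that(1)] SH(6) Comp_Id[OF that(1)] that(2) by simp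
    ultimately show "\<exists>!h. h \<in> Hom C B T \<and> h \<cdot> y = g" using gb by blast
  qed
qed

lemma biproduct_kernel: "is_biproduct C A B S a b x y \<Longrightarrow> is_kernel C a y"
proof -
  assume "is_biproduct C A B S a b x y"
  then have "is_biproduct (opposite C) B A S y x b a"
    unfolding is_biproduct_opposite using Add_commute Comp_in_Hom unfolding is_biproduct_def by metis
  then show ?thesis
    using preadditive_category.biproduct_cokernel[OF preadditive_category_opposite] by fastforce
qed

text \<open>The isomorphism is \<open>a' \<cdot> x \<boxplus> b' \<cdot> y\<close>. It and its
  counterpart in the other direction are inverse because a morphism out of a biproduct is determined
  by its two components.\<close>

lemma biproducts_iso:
  assumes S: "is_biproduct C A B S a b x y" and T: "is_biproduct C A B T a' b' x' y'"
  shows "\<exists>\<phi>\<in>Hom C S T. is_iso C \<phi> \<and> \<phi> \<cdot> a = a' \<and> y' \<cdot> \<phi> = y"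
proof -
  have "\<exists>\<phi>\<in>Hom C S T. \<phi> \<cdot> a = a' \<and> \<phi> \<cdot> b = b' \<and> x' \<cdot> \<phi> = x \<and> y' \<cdot> \<phi> = y"
    if S: "is_biproduct C A B S a b x y" and T: "is_biproduct C A B T a' b' x' y'"
    for S T a b x y a' b' x' y'
  proof -
    note SH = biproduct_Hom[OF S] and TH = biproduct_Hom[OF T]
    note \<phi> = biproduct_copair[OF S TH(1,2)]
    let ?\<phi> = "a' \<cdot> x \<boxplus> b' \<cdot> y"
    have ax: "a' \<cdot> x \<in> Hom C S T" and bY: "b' \<cdot> y \<in> Hom C S T" using SH TH Comp_in_Hom by blast+
    note ob = Hom_Obj[OF SH(1)] Hom_Obj[OF SH(2)]
    have "x' \<cdot> ?\<phi> = x"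
      using Comp_Add[OF ax bY TH(3)] Comp_assoc[OF SH(3) TH(1,3)] Comp_assoc[OF SH(4) TH(2,3)]
        TH(5,7) Id_Comp[OF SH(3)] Zer_Comp[OF SH(4)] Zer_Add[OF SH(3)] ob by simp
    moreover have "y' \<cdot> ?\<phi> = y"
      using Comp_Add[OF ax bY TH(4)] Comp_assoc[OF SH(3) TH(1,4)] Comp_assoc[OF SH(4) TH(2,4)]
        TH(6,8) Id_Comp[OF SH(4)] Zer_Comp[OF SH(3)] Zer_Add[OF SH(4)] ob by simp
    ultimately show ?thesis using \<phi> by blast
  qed
  note cmp = this
  have inv: "g \<cdot> f = Id C S"
    if S: "is_biproduct C A B S a b x y" and f: "f \<in> Hom C S T" "f \<cdot> a = a'" "f \<cdot> b = b'"
      and g: "g \<in> Hom C T S" "g \<cdot> a' = a" "g \<cdot> b' = b" for S T a b x y a' b' f g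
    using biproduct_copair_unique[OF S Comp_in_Hom[OF f(1) g(1)]] biproduct_Hom[OF S]
      Comp_assoc[OF _ f(1) g(1)] f g by simp
  obtain f where f: "f \<in> Hom C S T" "f \<cdot> a = a'" "f \<cdot> b = b'" "y' \<cdot> f = y" using cmp[OF S T] by blast
  obtain g where g: "g \<in> Hom C T S" "g \<cdot> a' = a" "g \<cdot> b' = b" using cmp[OF T S] by blast
  have "is_iso C f" using inv[OF S f(1-3) g] inv[OF T g f(1-3)] f(1) g(1)
    unfolding is_iso_def Hom_def by auto
  with f show ?thesis by blast
qed

end


section \<open>Conflations\<close>

definition conflation ::
  "('o, 'm) precat \<Rightarrow> ('m \<times> 'm) set \<Rightarrow> 'o \<Rightarrow> 'o \<Rightarrow> 'o \<Rightarrow> 'm \<Rightarrow> 'm \<Rightarrow> bool" where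
  "conflation C E L M N i p \<longleftrightarrow> (i, p) \<in> E \<and> i \<in> Hom C L M \<and> p \<in> Hom C M N"

lemma conflation_opposite [simp]:
  "conflation (opposite C) (E\<inverse>) L M N i p = conflation C E N M L p i"
  by (auto simp: conflation_def)

text \<open>The Yoneda form of \<open>Ext\<^sup>1(M, N) = 0\<close>, absolute or relative according to \<open>E\<close>.\<close>

definition splits :: "('o, 'm) precat \<Rightarrow> ('m \<times> 'm) set \<Rightarrow> 'o \<Rightarrow> 'o \<Rightarrow> bool" where
  "splits C E M N \<longleftrightarrow>
     (\<forall>T i p. conflation C E N T M i p \<longrightarrow> (\<exists>r\<in>Hom C T N. r \<cdot>\<^bsub>C\<^esub> i = Id C N))"

lemma right_perp_opposite [simp]:
  "right_perp (opposite C) van V = left_perp C (\<lambda>M N. van N M) V"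
  by (simp add: right_perp_def left_perp_def)

lemma left_perp_opposite [simp]:
  "left_perp (opposite C) van U = right_perp C (\<lambda>M N. van N M) U"
  by (simp add: right_perp_def left_perp_def)

text \<open>The common properties of an exact structure and of the class of all short exact sequences of
  an abelian category that are used below; they are stable under passage to the opposite category.\<close>

locale conflation_class = preadditive_category C for C :: "('o, 'm) precat" (structure) +
  fixes E :: "('m \<times> 'm) set"
  assumes kernel_cokernel: "E \<subseteq> kernel_cokernel_pairs C"
    and cokernel_closed: "\<lbrakk>(i, p) \<in> E; is_cokernel C p' i\<rbrakk> \<Longrightarrow> (i, p') \<in> E"
    and kernel_closed: "\<lbrakk>(i, p) \<in> E; is_kernel C i' p\<rbrakk> \<Longrightarrow> (i', p) \<in> E"
    and monic_Comp: "\<lbrakk>admissible_monic E i; admissible_monic E j; Cod C i = Dom C j\<rbrakk>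
                       \<Longrightarrow> admissible_monic E (j \<cdot> i)"
    and epic_Comp: "\<lbrakk>admissible_epic E p; admissible_epic E q; Cod C p = Dom C q\<rbrakk>
                       \<Longrightarrow> admissible_epic E (q \<cdot> p)"
    and pushout_exists: "\<lbrakk>admissible_monic E i; f \<in> Mor C; Dom C f = Dom C i\<rbrakk>
                       \<Longrightarrow> \<exists>i' f'. is_pushout C i f i' f'"
    and pushout_monic: "\<lbrakk>admissible_monic E i; is_pushout C i f i' f'\<rbrakk> \<Longrightarrow> admissible_monic E i'"
    and pullback_exists: "\<lbrakk>admissible_epic E p; f \<in> Mor C; Cod C f = Cod C p\<rbrakk>
                       \<Longrightarrow> \<exists>p' f'. is_pullback C p f p' f'"
    and pullback_epic: "\<lbrakk>admissible_epic E p; is_pullback C p f p' f'\<rbrakk> \<Longrightarrow> admissible_epic E p'"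
begin

text \<open>The assumptions come in dual pairs, apart from the self-dual
  \<open>kernel_cokernel\<close>. This makes every lemma of the locale available in dual
  form.\<close>

lemma conflation_class_opposite: "conflation_class (opposite C) (E\<inverse>)"
proof -
  interpret opp: preadditive_category "opposite C" by (rule preadditive_category_opposite)
  show ?thesis
  proof
    show "E\<inverse> \<subseteq> kernel_cokernel_pairs (opposite C)" using kernel_cokernel by auto
    show "(i, p') \<in> E\<inverse>" if "(i, p) \<in> E\<inverse>" "is_cokernel (opposite C) p' i" for i p p'
      using that kernel_closed[of p i p'] by simp
    show "(i', p) \<in> E\<inverse>" if "(i, p) \<in> E\<inverse>" "is_kernel (opposite C) i' p" for i p i'
      using that cokernel_closed[of p i i'] by simp
  qed (simp_all only: opposite_sel admissible_converse is_pushout_opposite is_pullback_opposite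
      monic_Comp epic_Comp pushout_exists pullback_exists, (rule pushout_monic pullback_epic, assumption+)+)
qed

lemma conflationI: "(i, p) \<in> E \<Longrightarrow> conflation C E (Dom C i) (Cod C i) (Cod C p) i p"
  using kernel_cokernel by (auto simp: conflation_def kernel_cokernel_pairs_def is_kernel_def Hom_def)

lemma conflation_zero: "conflation C E L M N i p \<Longrightarrow> p \<cdot> i = Zer C L N"
  using kernel_cokernel
  by (auto simp: conflation_def kernel_cokernel_pairs_def is_kernel_def Hom_def)

lemma conflation_factor_kernel:
  assumes "conflation C E L M N i p" "g \<in> Hom C T M" "p \<cdot> g = Zer C T N"
  shows "\<exists>h\<in>Hom C T L. i \<cdot> h = g"
proof -
  have "is_kernel C i p" "Dom C i = L" "Dom C p = M" "Cod C p = N"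
    using assms(1) kernel_cokernel by (auto simp: conflation_def kernel_cokernel_pairs_def Hom_def)
  with assms(2,3) show ?thesis unfolding is_kernel_def by metis
qed

lemma conflation_monic:
  assumes c: "conflation C E L M N i p" and g: "g \<in> Hom C T L" and h: "h \<in> Hom C T L"
    and eq: "i \<cdot> g = i \<cdot> h"
  shows "g = h"
proof -
  have ker: "is_kernel C i p" and i: "i \<in> Hom C L M" and p: "p \<in> Hom C M N"
    using c kernel_cokernel by (auto simp: conflation_def kernel_cokernel_pairs_def)
  have "p \<cdot> (i \<cdot> g) = Zer C T N"
    using Comp_assoc[OF g i p] conflation_zero[OF c] Zer_Comp[OF g] Hom_Obj[OF p] by simp
  moreover have "i \<cdot> g \<in> Hom C T M" using g i by (rule Comp_in_Hom)
  moreover have "Dom C i = L" "Dom C p = M" "Cod C p = N" using i p by (auto simp: Hom_def)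
  ultimately have "\<exists>!x. x \<in> Hom C T L \<and> i \<cdot> x = i \<cdot> g"
    using ker unfolding is_kernel_def by metis
  with g h eq show ?thesis by metis
qed

lemmas conflation_factor_cokernel =
  conflation_class.conflation_factor_kernel[OF conflation_class_opposite, simplified]
lemmas conflation_epic =
  conflation_class.conflation_monic[OF conflation_class_opposite, simplified]

text \<open>If \<open>r\<close> is a retraction of \<open>i\<close>, then \<open>1 - i r\<close> factors through \<open>p\<close>, by a section.\<close>

lemma retraction_biproduct:
  assumes c: "conflation C E L M N i p" and r: "r \<in> Hom C M L" "r \<cdot> i = Id C L"
  shows "\<exists>s. is_biproduct C L N M i s r p"
proof -
  have i: "i \<in> Hom C L M" and p: "p \<in> Hom C M N" using c by (auto simp: conflation_def)
  note ob = Hom_Obj[OF i] Hom_Obj[OF p]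
  have ir: "i \<cdot> r \<in> Hom C M M" using r i Comp_in_Hom by blast
  obtain d where d: "d \<in> Hom C M M" "d \<boxplus> i \<cdot> r = Id C M"
    using difference_exists[OF Id_in_Hom ir] ob by blast
  have di: "d \<cdot> i \<in> Hom C L M" using d i Comp_in_Hom by blast
  have "d \<cdot> i \<boxplus> i = i"
    using Add_Comp[OF i d(1) ir] d(2) Comp_assoc[OF i r(1) i] r(2) Comp_Id[OF i] Id_Comp[OF i]
    by simp
  then have "d \<cdot> i = Zer C L M"
    using Add_right_cancel[OF di Zer_in_Hom i] Zer_Add[OF i] ob by simp
  then obtain s where s: "s \<in> Hom C N M" "s \<cdot> p = d"
    using conflation_factor_cokernel[OF c d(1)] by blast
  have pd: "p \<cdot> d \<in> Hom C M N" and rd: "r \<cdot> d \<in> Hom C M L" using d p r Comp_in_Hom by blast+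
  have "p \<cdot> d \<boxplus> Zer C M N = p"
    using Comp_Add[OF d(1) ir p] d(2) Comp_assoc[OF r(1) i p] conflation_zero[OF c]
      Zer_Comp[OF r(1)] Comp_Id[OF p] ob by simp
  then have "p \<cdot> s \<cdot> p = p" using Zer_Add[OF pd] s by simp
  then have ps: "p \<cdot> s = Id C N"
    using conflation_epic[OF c, of "p \<cdot> s" N "Id C N"] Comp_in_Hom[OF s(1) p] Id_in_Hom Id_Comp[OF p] ob
      Comp_assoc[OF p s(1) p]
    by simp
  have "r \<cdot> d \<boxplus> r = r"
    using Comp_Add[OF d(1) ir r(1)] d(2) Comp_assoc[OF r(1) i r(1)] r(2) Comp_Id[OF r(1)]
      Id_Comp[OF r(1)] by simp
  then have "r \<cdot> d = Zer C M L"
    using Add_right_cancel[OF rd Zer_in_Hom r(1)] Zer_Add[OF r(1)] ob by simp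
  then have "(r \<cdot> s) \<cdot> p = Zer C N L \<cdot> p"
    using Comp_assoc[OF p s(1) r(1)] s(2) Zer_Comp[OF p] ob by simp
  then have "r \<cdot> s = Zer C N L"
    using conflation_epic[OF c, of "r \<cdot> s" L "Zer C N L"] Comp_in_Hom[OF s(1) r(1)] Zer_in_Hom ob by simp
  moreover have "i \<cdot> r \<boxplus> s \<cdot> p = Id C M" using Add_commute[OF d(1) ir] d(2) s(2) by simp
  ultimately show ?thesis
    using i p r s(1) ps conflation_zero[OF c] unfolding is_biproduct_def by blast
qed

lemma conflation_Hom:
  assumes "conflation C E L M N i p"
  shows "i \<in> Hom C L M" "p \<in> Hom C M N" "L \<in> Obj C" "M \<in> Obj C" "N \<in> Obj C"
  using assms Hom_Obj unfolding conflation_def by blast+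

lemma conflation_admissible:
  assumes "conflation C E L M N i p" shows "admissible_monic E i" "admissible_epic E p"
  using assms unfolding conflation_def admissible_monic_def admissible_epic_def by blast+

lemma splits_section:
  assumes "splits C E M N" "conflation C E N T M i p"
  shows "\<exists>s\<in>Hom C M T. p \<cdot> s = Id C M"
proof -
  obtain r where "r \<in> Hom C T N" "r \<cdot> i = Id C N" using assms unfolding splits_def by blast
  from retraction_biproduct[OF assms(2) this] show ?thesis unfolding is_biproduct_def by blast
qed

text \<open>By \<open>splits_section\<close> the same extension has a section, which is a retraction
  in the opposite category; two applications give an equivalence.\<close>

lemma splits_imp_splits_opposite: "splits C E M N \<Longrightarrow> splits (opposite C) (E\<inverse>) N M"
  unfolding splits_def[of "opposite C"] using splits_section by simp

lemma splits_opposite [simp]: "splits (opposite C) (E\<inverse>) N M \<longleftrightarrow> splits C E M N"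
  using splits_imp_splits_opposite
    conflation_class.splits_imp_splits_opposite[OF conflation_class_opposite, of N M] by auto

lemma splitsI_section:
  assumes "\<And>T i p. conflation C E N T M i p \<Longrightarrow> \<exists>s\<in>Hom C M T. p \<cdot> s = Id C M"
  shows "splits C E M N"
proof -
  have "splits (opposite C) (E\<inverse>) N M" unfolding splits_def using assms by simp
  then show ?thesis by simp
qed

text \<open>A push-out has the same cokernel: a morphism out of \<open>Q\<close> that kills
  \<open>i'\<close> amounts to a morphism out of \<open>M\<close> that kills \<open>i\<close>, hence
  to one out of \<open>N\<close>.\<close>

lemma pushout_conflation:
  assumes c: "conflation C E L M N i p" and f: "f \<in> Hom C L L'" and po: "is_pushout C i f i' f'"
  shows "\<exists>p'. conflation C E L' (Cod C i') N i' p' \<and> p' \<cdot> f' = p"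
proof -
  note i = conflation_Hom(1)[OF c] and p = conflation_Hom(2)[OF c]
  note ob = conflation_Hom(3-)[OF c] Hom_Obj[OF f]
  define Q where "Q = Cod C i'"
  have i': "i' \<in> Hom C L' Q" and f': "f' \<in> Hom C M Q"
    using is_pushout_Hom[OF po i f] by (simp_all add: Q_def)
  have comm: "f' \<cdot> i = i' \<cdot> f"
    and univ: "\<And>T u v. \<lbrakk>u \<in> Hom C L' T; v \<in> Hom C M T; v \<cdot> i = u \<cdot> f\<rbrakk>
      \<Longrightarrow> \<exists>!h. h \<in> Hom C Q T \<and> h \<cdot> i' = u \<and> h \<cdot> f' = v"
    using po unfolding is_pushout_iff[OF i f i' f'] by blast+
  \<comment> \<open>The zero morphism on \<open>L'\<close> and \<open>p\<close> on \<open>M\<close>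
    agree on \<open>L\<close>, so they induce \<open>p'\<close>.\<close>
  have "p \<cdot> i = Zer C L' N \<cdot> f" using conflation_zero[OF c] Zer_Comp[OF f] ob by simp
  then obtain p' where p': "p' \<in> Hom C Q N" "p' \<cdot> i' = Zer C L' N" "p' \<cdot> f' = p"
    using univ[OF Zer_in_Hom p] ob by blast
  have "is_cokernel C p' i'" unfolding is_cokernel_iff[OF i' p'(1)]
  proof (intro conjI allI ballI impI p')
    fix B g assume g: "g \<in> Hom C Q B" and z: "g \<cdot> i' = Zer C L' B"
    note B = Hom_Obj(2)[OF g]
    have gf: "g \<cdot> f' \<in> Hom C M B" using f' g by (rule Comp_in_Hom)
    have gfi: "(g \<cdot> f') \<cdot> i = Zer C L' B \<cdot> f"
      using Comp_assoc[OF i f' g] comm Comp_assoc[OF f i' g] z by simp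
    then obtain h where h: "h \<in> Hom C N B" "h \<cdot> p = g \<cdot> f'"
      using conflation_factor_cokernel[OF c gf] Zer_Comp[OF f B] by auto
    have hp: "h \<cdot> p' \<in> Hom C Q B" using p'(1) h(1) by (rule Comp_in_Hom)
    have "(h \<cdot> p') \<cdot> i' = Zer C L' B" "(h \<cdot> p') \<cdot> f' = g \<cdot> f'"
      using Comp_assoc[OF i' p'(1) h(1)] Comp_assoc[OF f' p'(1) h(1)] p' h(2) Comp_Zer[OF h(1)] ob
      by simp_all
    then have "h \<cdot> p' = g"
      using univ[OF Zer_in_Hom[OF _ B] gf gfi] hp g z ob by blast
    moreover have "h' = h" if h': "h' \<in> Hom C N B" "h' \<cdot> p' = g" for h'
      using conflation_epic[OF c h'(1) h(1)] Comp_assoc[OF f' p'(1) h'(1)] h'(2) h(2) p'(3) by simp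
    ultimately show "\<exists>!h. h \<in> Hom C N B \<and> h \<cdot> p' = g" using h(1) by blast
  qed
  \<comment> \<open>The axiom provides some conflation with monic \<open>i'\<close>; the cokernel
    \<open>p'\<close> may then replace its epic.\<close>
  moreover obtain p'' where "(i', p'') \<in> E"
    using pushout_monic[OF conflation_admissible(1)[OF c] po] unfolding admissible_monic_def by blast
  ultimately have "(i', p') \<in> E" by (rule cokernel_closed[rotated])
  then show ?thesis using i' p' unfolding conflation_def Q_def by blast
qed

lemma pushout_obtain:
  assumes c: "conflation C E L M N i p" and f: "f \<in> Hom C L L'"
  obtains Q i' f' p' where "is_pushout C i f i' f'" "conflation C E L' Q N i' p'"
    "f' \<in> Hom C M Q" "f' \<cdot> i = i' \<cdot> f" "p' \<cdot> f' = p"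
proof -
  note i = conflation_Hom(1)[OF c]
  have "f \<in> Mor C" "Dom C f = Dom C i" using f i by (simp_all add: Hom_def)
  then obtain i' f' where po: "is_pushout C i f i' f'"
    using pushout_exists[OF conflation_admissible(1)[OF c]] by blast
  note ty = is_pushout_Hom[OF po i f]
  have "f' \<cdot> i = i' \<cdot> f" using po unfolding is_pushout_iff[OF i f ty] by blast
  then show thesis using that pushout_conflation[OF c f po] po ty(2) by blast
qed

text \<open>The pushout of two admissible monics, read in both directions.\<close>

lemma pushout_conflations:
  assumes F: "conflation_class C F"
    and c: "conflation C E L M N i p" and d: "conflation C F L M' N' j q"
  shows "\<exists>Q i' p' j' q'. conflation C E M' Q N i' p' \<and> conflation C F M Q N' j' q'"
proof -
  interpret F: conflation_class C F by (rule F)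
  note i = conflation_Hom(1)[OF c] and j = F.conflation_Hom(1)[OF d]
  obtain Q i' j' p' where po: "is_pushout C i j i' j'" and c': "conflation C E M' Q N i' p'"
    and j': "j' \<in> Hom C M Q"
    using pushout_obtain[OF c j] by metis
  have "Cod C j' = Q" using j' by (auto simp: Hom_def)
  with F.pushout_conflation[OF d i is_pushout_sym[OF po]] c' show ?thesis by auto
qed

text \<open>Push the conflation out along \<open>f\<close>: a retraction of the new monic, composed
  with \<open>f'\<close>, extends \<open>f\<close>.\<close>

lemma splits_extend:
  assumes s: "splits C E M N" and c: "conflation C E L T M i p" and f: "f \<in> Hom C L N"
  shows "\<exists>g\<in>Hom C T N. g \<cdot> i = f"
proof -
  note i = conflation_Hom(1)[OF c]
  obtain Q i' f' p' where c': "conflation C E N Q M i' p'" and f': "f' \<in> Hom C T Q"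
    and comm: "f' \<cdot> i = i' \<cdot> f"
    using pushout_obtain[OF c f] by metis
  obtain r where r: "r \<in> Hom C Q N" "r \<cdot> i' = Id C N" using s c' unfolding splits_def by blast
  have "(r \<cdot> f') \<cdot> i = f"
    using Comp_assoc[OF i f' r(1)] comm Comp_assoc[OF f conflation_Hom(1)[OF c'] r(1)] r(2)
      Id_Comp[OF f] by simp
  then show ?thesis using Comp_in_Hom[OF f' r(1)] by blast
qed

section \<open>Relative projectives and presentations\<close>

lemma projective_lift:
  assumes "P \<in> projectives C E" "conflation C E L M N i p" "f \<in> Hom C P N"
  shows "\<exists>g\<in>Hom C P M. p \<cdot> g = f"
proof -
  have "Dom C p = M" "Cod C p = N" using conflation_Hom(2)[OF assms(2)] by (auto simp: Hom_def)
  with assms(1,3) conflation_admissible(2)[OF assms(2)] show ?thesis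
    unfolding projectives_def by blast
qed

lemma projective_splits: assumes "P \<in> projectives C E" shows "splits C E P N"
proof (rule splitsI_section)
  fix T i p assume c: "conflation C E N T P i p"
  show "\<exists>s\<in>Hom C P T. p \<cdot> s = Id C P"
    using projective_lift[OF assms c Id_in_Hom[OF conflation_Hom(5)[OF c]]] .
qed

text \<open>With \<open>P\<close> projective, the first extension group is the cokernel of the
  restriction from \<open>Hom C P N\<close> to \<open>Hom C K N\<close>, so surjectivity of this
  restriction splits every extension.\<close>

lemma splits_presentation:
  assumes c: "conflation C E K P M i p" and P: "P \<in> projectives C E"
    and ext: "\<And>f. f \<in> Hom C K N \<Longrightarrow> \<exists>h\<in>Hom C P N. h \<cdot> i = f"
  shows "splits C E M N"
proof (rule splitsI_section)
  fix T j q assume d: "conflation C E N T M j q"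
  note i = conflation_Hom(1)[OF c] and p = conflation_Hom(2)[OF c]
  note j = conflation_Hom(1)[OF d] and q = conflation_Hom(2)[OF d]
  note ob = conflation_Hom(3-)[OF c] conflation_Hom(3-)[OF d]
  \<comment> \<open>Lift \<open>p\<close> to the middle term \<open>T\<close>; on \<open>K\<close>
    this lift has values in \<open>N\<close>, where it is the map \<open>f\<close> to be
    extended.\<close>
  obtain g where g: "g \<in> Hom C P T" "q \<cdot> g = p" using projective_lift[OF P d p] by blast
  have gi: "g \<cdot> i \<in> Hom C K T" using i g(1) by (rule Comp_in_Hom)
  have "q \<cdot> (g \<cdot> i) = Zer C K M" using Comp_assoc[OF i g(1) q] g(2) conflation_zero[OF c] by simp
  then obtain f where f: "f \<in> Hom C K N" "j \<cdot> f = g \<cdot> i"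
    using conflation_factor_kernel[OF d gi] by blast
  obtain h where h: "h \<in> Hom C P N" "h \<cdot> i = f" using ext[OF f(1)] by blast
  have jh: "j \<cdot> h \<in> Hom C P T" using h(1) j by (rule Comp_in_Hom)
  \<comment> \<open>\<open>d'\<close> is \<open>g - j \<cdot> h\<close>. It vanishes on
    \<open>K\<close>, so it descends to \<open>M\<close>, and since \<open>q\<close> kills
    \<open>j\<close> the descended map is a section.\<close>
  obtain d' where d': "d' \<in> Hom C P T" "d' \<boxplus> j \<cdot> h = g" using difference_exists[OF g(1) jh] by blast
  have di: "d' \<cdot> i \<in> Hom C K T" using i d'(1) by (rule Comp_in_Hom)
  have "d' \<cdot> i \<boxplus> g \<cdot> i = g \<cdot> i"
    using Add_Comp[OF i d'(1) jh] d'(2) Comp_assoc[OF i h(1) j] h(2) f(2) by simp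
  then have "d' \<cdot> i = Zer C K T"
    using Add_right_cancel[OF di Zer_in_Hom gi] Zer_Add[OF gi] ob by simp
  then obtain s where s: "s \<in> Hom C M T" "s \<cdot> p = d'"
    using conflation_factor_cokernel[OF c d'(1)] by blast
  have qd: "q \<cdot> d' \<in> Hom C P M" using d'(1) q by (rule Comp_in_Hom)
  have "q \<cdot> d' \<boxplus> Zer C P M = p"
    using Comp_Add[OF d'(1) jh q] d'(2) g(2) Comp_assoc[OF h(1) j q] conflation_zero[OF d]
      Zer_Comp[OF h(1)] ob by simp
  then have "(q \<cdot> s) \<cdot> p = Id C M \<cdot> p"
    using Zer_Add(2)[OF qd] Comp_assoc[OF p s(1) q] s(2) Id_Comp[OF p] by simp
  then have "q \<cdot> s = Id C M"
    using conflation_epic[OF c, of "q \<cdot> s" M "Id C M"] Comp_in_Hom[OF s(1) q] Id_in_Hom ob by simp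
  then show "\<exists>s\<in>Hom C M T. q \<cdot> s = Id C M" using s(1) by blast
qed

section \<open>Completeness and enough projectives by conflations, with dual forms\<close>

lemma is_complete_iff:
  "is_complete C E U V \<longleftrightarrow> (\<forall>M\<in>Obj C.
     (\<exists>L T i p. conflation C E L T M i p \<and> L \<in> V \<and> T \<in> U) \<and>
     (\<exists>T N i p. conflation C E M T N i p \<and> T \<in> V \<and> N \<in> U))"
proof -
  have 1: "(\<exists>i p. (i, p) \<in> E \<and> Dom C i \<in> V \<and> Cod C i \<in> U \<and> Cod C p = M) \<longleftrightarrow>
     (\<exists>L T i p. conflation C E L T M i p \<and> L \<in> V \<and> T \<in> U)" for M
    using conflationI by (auto simp: conflation_def Hom_def)
  have 2: "(\<exists>i p. (i, p) \<in> E \<and> Dom C i = M \<and> Cod C i \<in> V \<and> Cod C p \<in> U) \<longleftrightarrow>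
     (\<exists>T N i p. conflation C E M T N i p \<and> T \<in> V \<and> N \<in> U)" for M
    using conflationI by (auto simp: conflation_def Hom_def)
  show ?thesis unfolding is_complete_def 1 2 ..
qed

lemma enough_projectives_iff:
  "enough_projectives C E \<longleftrightarrow>
     (\<forall>M\<in>Obj C. \<exists>K P i p. conflation C E K P M i p \<and> P \<in> projectives C E)"
proof -
  have "(\<exists>p. admissible_epic E p \<and> Dom C p \<in> projectives C E \<and> Cod C p = M) \<longleftrightarrow>
     (\<exists>K P i p. conflation C E K P M i p \<and> P \<in> projectives C E)" for M
  proof
    assume "\<exists>p. admissible_epic E p \<and> Dom C p \<in> projectives C E \<and> Cod C p = M"
    then obtain i p where "(i, p) \<in> E" "Dom C p \<in> projectives C E" "Cod C p = M"
      unfolding admissible_epic_def by blast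
    moreover from this have "Dom C p = Cod C i"
      using conflationI[of i p] by (simp add: conflation_def Hom_def)
    ultimately show "\<exists>K P i p. conflation C E K P M i p \<and> P \<in> projectives C E"
      using conflationI[of i p] by metis
  qed (auto simp: conflation_def Hom_def admissible_epic_def)
  then show ?thesis unfolding enough_projectives_def by simp
qed

lemmas splits_lift =
  conflation_class.splits_extend[OF conflation_class_opposite, simplified]
lemmas injective_extend =
  conflation_class.projective_lift[OF conflation_class_opposite, simplified]
lemmas enough_injectives_iff =
  conflation_class.enough_projectives_iff[OF conflation_class_opposite, simplified]

lemma pullback_conflations:
  assumes F: "conflation_class C F"
    and c: "conflation C E L M N i p" and d: "conflation C F L' M' N j q"
  shows "\<exists>Q i' p' j' q'. conflation C E L Q M' i' p' \<and> conflation C F L' Q M j' q'"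
  using conflation_class.pushout_conflations[OF conflation_class_opposite
      conflation_class.conflation_class_opposite[OF F], of N M L p i M' L' q j] c d
  by simp blast

lemma is_complete_opposite [simp]: "is_complete (opposite C) (E\<inverse>) V U = is_complete C E U V"
  unfolding is_complete_iff conflation_class.is_complete_iff[OF conflation_class_opposite]
  by simp blast

text \<open>Extend \<open>a\<close> over the extension and compose with \<open>b\<close>. Isomorphic
  objects and direct summands are both retracts, so this serves two of the closure properties of a
  subcategory.\<close>

lemma splits_retract:
  assumes s: "splits C E M S" and a: "a \<in> Hom C A S" and b: "b \<in> Hom C S A" and ba: "b \<cdot> a = Id C A"
  shows "splits C E M A"
  unfolding splits_def
proof (intro allI impI)
  fix T i p assume c: "conflation C E A T M i p"
  note i = conflation_Hom(1)[OF c]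
  obtain g where g: "g \<in> Hom C T S" "g \<cdot> i = a" using splits_extend[OF s c a] by blast
  have "(b \<cdot> g) \<cdot> i = Id C A" using Comp_assoc[OF i g(1) b] g(2) ba by simp
  then show "\<exists>r\<in>Hom C T A. r \<cdot> i = Id C A" using Comp_in_Hom[OF g(1) b] by blast
qed

lemma splits_direct_sum:
  assumes A: "splits C E M A" and B: "splits C E M B" and S: "is_biproduct C A B S a b x y"
  shows "splits C E M S"
  unfolding splits_def
proof (intro allI impI)
  fix T i p assume c: "conflation C E S T M i p"
  note i = conflation_Hom(1)[OF c]
  have ty: "a \<in> Hom C A S" "b \<in> Hom C B S" "x \<in> Hom C S A" "y \<in> Hom C S B"
    and eq: "a \<cdot> x \<boxplus> b \<cdot> y = Id C S"
    using S unfolding is_biproduct_def by blast+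
  obtain g where g: "g \<in> Hom C T A" "g \<cdot> i = x" using splits_extend[OF A c ty(3)] by blast
  obtain h where h: "h \<in> Hom C T B" "h \<cdot> i = y" using splits_extend[OF B c ty(4)] by blast
  have ag: "a \<cdot> g \<in> Hom C T S" and bh: "b \<cdot> h \<in> Hom C T S" using g h ty Comp_in_Hom by blast+
  have "(a \<cdot> g \<boxplus> b \<cdot> h) \<cdot> i = Id C S"
    using Add_Comp[OF i ag bh] Comp_assoc[OF i g(1) ty(1)] Comp_assoc[OF i h(1) ty(2)] g h eq by simp
  then show "\<exists>r\<in>Hom C T S. r \<cdot> i = Id C S" using Add_in_Hom[OF ag bh] by blast
qed

lemma splits_zero_object: assumes Z: "is_zero_object C Z" shows "splits C E M Z"
  unfolding splits_def
proof (intro allI impI)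
  fix T i p assume c: "conflation C E Z T M i p"
  note i = conflation_Hom(1)[OF c] and ob = conflation_Hom(3-)[OF c]
  have "Zer C T Z \<cdot> i \<in> Hom C Z Z" "Id C Z \<in> Hom C Z Z"
    using Comp_in_Hom[OF i Zer_in_Hom] Id_in_Hom ob by blast+
  then have "Zer C T Z \<cdot> i = Id C Z" using Z ob(1) unfolding is_zero_object_def by blast
  then show "\<exists>r\<in>Hom C T Z. r \<cdot> i = Id C Z" using Zer_in_Hom ob by blast
qed

lemma subcategory_right_perp: "subcategory C (right_perp C (splits C E) U)"
  unfolding subcategory_def
proof (intro conjI allI impI ballI)
  fix Z assume "is_zero_object C Z"
  then show "Z \<in> right_perp C (splits C E) U"
    using splits_zero_object unfolding right_perp_def is_zero_object_def by blast
next
  fix A B S assume AB: "A \<in> right_perp C (splits C E) U" "B \<in> right_perp C (splits C E) U"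
    and "is_direct_sum C A B S"
  then obtain a b x y where S: "is_biproduct C A B S a b x y" unfolding is_direct_sum_def by blast
  then have "S \<in> Obj C" using Hom_Obj(2) unfolding is_biproduct_def by blast
  then show "S \<in> right_perp C (splits C E) U"
    using AB splits_direct_sum[OF _ _ S] by (simp add: right_perp_def)
next
  fix A B assume A: "A \<in> right_perp C (splits C E) U" and "isomorphic C A B"
  then obtain f g where "f \<in> Hom C A B" "g \<in> Hom C B A" "f \<cdot> g = Id C B"
    unfolding isomorphic_def is_iso_def Hom_def by blast
  then show "B \<in> right_perp C (splits C E) U"
    using A splits_retract Hom_Obj unfolding right_perp_def by blast
next
  fix A B S assume S: "S \<in> right_perp C (splits C E) U" and "is_direct_sum C A B S"
  then obtain a x where "a \<in> Hom C A S" "x \<in> Hom C S A" "x \<cdot> a = Id C A"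
    unfolding is_direct_sum_def is_biproduct_def by blast
  then show "A \<in> right_perp C (splits C E) U"
    using S splits_retract Hom_Obj unfolding right_perp_def by blast
qed (simp add: right_perp_def)


section \<open>Relative cotorsion pairs\<close>

text \<open>For an extension \<open>T\<close> of \<open>X\<close> by \<open>M\<close>, a section of its push-out along \<open>p\<close> is lifted along
  \<open>T \<rightarrow> Q\<close>, whose kernel is \<open>L\<close>.\<close>

lemma splits_extension:
  assumes c: "conflation C E L M N i p" and L: "splits C E X L" and N: "splits C E X N"
  shows "splits C E X M"
proof (rule splitsI_section)
  fix T j q assume d: "conflation C E M T X j q"
  note i = conflation_Hom(1)[OF c] and p = conflation_Hom(2)[OF c]
  note j = conflation_Hom(1)[OF d] and q = conflation_Hom(2)[OF d]
  obtain Q j' f q' where po: "is_pushout C j p j' f" and d': "conflation C E N Q X j' q'"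
    and f: "f \<in> Hom C T Q" and comm: "f \<cdot> j = j' \<cdot> p" "q' \<cdot> f = q"
    using pushout_obtain[OF d p] by metis
  note j' = conflation_Hom(1)[OF d'] and q' = conflation_Hom(2)[OF d']
  have univ: "\<And>B u v. \<lbrakk>u \<in> Hom C N B; v \<in> Hom C T B; v \<cdot> j = u \<cdot> p\<rbrakk>
      \<Longrightarrow> \<exists>!h. h \<in> Hom C Q B \<and> h \<cdot> j' = u \<and> h \<cdot> f = v"
    using po unfolding is_pushout_iff[OF j p j' f] by blast
  have ji: "j \<cdot> i \<in> Hom C L T" using i j by (rule Comp_in_Hom)
  \<comment> \<open>\<open>L \<rightarrow> T \<rightarrow> Q\<close> is a conflation: a morphism on
    \<open>T\<close> that kills \<open>L\<close> restricts on \<open>M\<close> to one that factors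
    through \<open>N\<close>, and the push-out glues the two.\<close>
  have "is_cokernel C f (j \<cdot> i)" unfolding is_cokernel_iff[OF ji f]
  proof (intro conjI allI ballI impI)
    show "f \<cdot> (j \<cdot> i) = Zer C L Q"
      using Comp_assoc[OF i j f] Comp_assoc[OF i p j'] comm conflation_zero[OF c] Comp_Zer[OF j']
        conflation_Hom(3)[OF c] by simp
  next
    fix B g assume g: "g \<in> Hom C T B" "g \<cdot> (j \<cdot> i) = Zer C L B"
    have gj: "g \<cdot> j \<in> Hom C M B" using j g(1) by (rule Comp_in_Hom)
    obtain u where u: "u \<in> Hom C N B" "u \<cdot> p = g \<cdot> j"
      using conflation_factor_cokernel[OF c gj] Comp_assoc[OF i j g(1)] g(2) by auto
    have "h \<cdot> j' = u" if h: "h \<in> Hom C Q B" "h \<cdot> f = g" for h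
      using conflation_epic[OF c Comp_in_Hom[OF j' h(1)] u(1)] Comp_assoc[OF p j' h(1)]
        Comp_assoc[OF j f h(1)] comm u(2) h(2) by simp
    then show "\<exists>!h. h \<in> Hom C Q B \<and> h \<cdot> f = g" using univ[OF u(1) g(1)] u(2) by auto
  qed
  moreover have "admissible_monic E (j \<cdot> i)"
    using monic_Comp[OF conflation_admissible(1)[OF c] conflation_admissible(1)[OF d]] i j
    by (simp add: Hom_def)
  ultimately have e: "conflation C E L T Q (j \<cdot> i) f"
    using cokernel_closed ji f unfolding conflation_def admissible_monic_def by blast
  obtain s where s: "s \<in> Hom C X Q" "q' \<cdot> s = Id C X" using splits_section[OF N d'] by blast
  obtain t where t: "t \<in> Hom C X T" "f \<cdot> t = s" using splits_lift[OF L e s(1)] by blast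
  have "q \<cdot> t = Id C X" using Comp_assoc[OF t(1) f q'] comm(2) t(2) s(2) by simp
  with t(1) show "\<exists>s\<in>Hom C X T. q \<cdot> s = Id C X" by blast
qed

lemma right_perp_extension:
  assumes "conflation C E L M N i p" "L \<in> right_perp C (splits C E) U"
    "N \<in> right_perp C (splits C E) U"
  shows "M \<in> right_perp C (splits C E) U"
  using assms splits_extension conflation_Hom(4)[OF assms(1)] unfolding right_perp_def by blast

text \<open>Given an extension \<open>T\<close> of \<open>M\<close> by \<open>N\<close>, take \<open>W \<rightarrow> T\<close> admissible epic with \<open>W\<close> in \<open>U\<close>.
  The kernel \<open>K\<close> of \<open>W \<rightarrow> M\<close> is then in \<open>U\<close>, so that \<open>K \<rightarrow> N\<close> lifts to \<open>M'\<close> and then extends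
  to \<open>W\<close>; this replaces dimension shifting with \<open>Ext\<^sup>2\<close>.\<close>

lemma right_perp_cokernel:
  assumes complete: "is_complete C E U V" and V: "V = right_perp C (splits C E) U"
    and closed: "\<And>L M N i p. \<lbrakk>conflation C E L M N i p; M \<in> U; N \<in> U\<rbrakk> \<Longrightarrow> L \<in> U"
    and c: "conflation C E L M' N a d" and LM: "L \<in> V" "M' \<in> V"
  shows "N \<in> V"
proof -
  note dH = conflation_Hom(2)[OF c]
  have "splits C E M N" if M: "M \<in> U" for M
  proof (rule splitsI_section)
    fix T j q assume e: "conflation C E N T M j q"
    note j = conflation_Hom(1)[OF e] and q = conflation_Hom(2)[OF e]
    note ob = conflation_Hom(3-)[OF e]
    obtain Y W y p where w: "conflation C E Y W T y p" "W \<in> U"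
      using complete ob unfolding is_complete_iff by blast
    note p = conflation_Hom(2)[OF w(1)]
    have qp: "q \<cdot> p \<in> Hom C W M" using p q by (rule Comp_in_Hom)
    \<comment> \<open>Composites of admissible epics are admissible, so
      \<open>W \<rightarrow> M\<close> has a kernel \<open>K\<close> in a conflation, and
      \<open>closed\<close> puts \<open>K\<close> into \<open>U\<close>.\<close>
    have "admissible_epic E (q \<cdot> p)"
      using epic_Comp[OF conflation_admissible(2)[OF w(1)] conflation_admissible(2)[OF e]] p q
      by (simp add: Hom_def)
    then obtain k where "(k, q \<cdot> p) \<in> E" unfolding admissible_epic_def by blast
    then obtain K where k: "conflation C E K W M k (q \<cdot> p)"
      using conflationI[of k "q \<cdot> p"] qp by (fastforce simp: conflation_def Hom_def)
    note kH = conflation_Hom(1)[OF k]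
    have K: "K \<in> U" using closed[OF k w(2) M] .
    have pk: "p \<cdot> k \<in> Hom C K T" using kH p by (rule Comp_in_Hom)
    obtain f where f: "f \<in> Hom C K N" "j \<cdot> f = p \<cdot> k"
      using conflation_factor_kernel[OF e pk] Comp_assoc[OF kH p q] conflation_zero[OF k] by auto
    have "splits C E K L" "splits C E M M'" using K M LM V unfolding right_perp_def by blast+
    then obtain g where g: "g \<in> Hom C K M'" "d \<cdot> g = f" using splits_lift[OF _ c f(1)] by blast
    obtain h where h: "h \<in> Hom C W M'" "h \<cdot> k = g"
      using splits_extend[OF \<open>splits C E M M'\<close> k g(1)] by blast
    have dh: "d \<cdot> h \<in> Hom C W N" using h(1) dH by (rule Comp_in_Hom)
    have jdh: "j \<cdot> (d \<cdot> h) \<in> Hom C W T" using dh j by (rule Comp_in_Hom)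
    have jdhk: "(j \<cdot> (d \<cdot> h)) \<cdot> k = p \<cdot> k"
      using Comp_assoc[OF kH dh j] Comp_assoc[OF kH h(1) dH] h(2) g(2) f(2) by simp
    \<comment> \<open>\<open>x\<close> is \<open>p - j \<cdot> (d \<cdot> h)\<close>, a correction
      of \<open>p\<close> that vanishes on \<open>K\<close> but has the same composite with
      \<open>q\<close>. It therefore descends to a section of \<open>q\<close>.\<close>
    obtain x where x: "x \<in> Hom C W T" "x \<boxplus> j \<cdot> (d \<cdot> h) = p"
      using difference_exists[OF p jdh] by blast
    have xk: "x \<cdot> k \<in> Hom C K T" using kH x(1) by (rule Comp_in_Hom)
    have "x \<cdot> k \<boxplus> p \<cdot> k = p \<cdot> k" using Add_Comp[OF kH x(1) jdh] x(2) jdhk by simp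
    then have "x \<cdot> k = Zer C K T"
      using Add_right_cancel[OF xk Zer_in_Hom pk] Zer_Add[OF pk] Hom_Obj[OF pk] by simp
    then obtain s where s: "s \<in> Hom C M T" "s \<cdot> (q \<cdot> p) = x"
      using conflation_factor_cokernel[OF k x(1)] by blast
    have qx: "q \<cdot> x \<in> Hom C W M" using x(1) q by (rule Comp_in_Hom)
    have "q \<cdot> x \<boxplus> Zer C W M = q \<cdot> p"
      using Comp_Add[OF x(1) jdh q] x(2) Comp_assoc[OF dh j q] conflation_zero[OF e]
        Zer_Comp[OF dh] ob by simp
    then have "(q \<cdot> s) \<cdot> (q \<cdot> p) = Id C M \<cdot> (q \<cdot> p)"
      using Zer_Add(2)[OF qx] Comp_assoc[OF qp s(1) q] s(2) Id_Comp[OF qp] by simp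
    then have "q \<cdot> s = Id C M"
      using conflation_epic[OF k, of "q \<cdot> s" M "Id C M"] Comp_in_Hom[OF s(1) q] Id_in_Hom ob by simp
    with s(1) show "\<exists>s\<in>Hom C M T. q \<cdot> s = Id C M" by blast
  qed
  then show ?thesis using V conflation_Hom(5)[OF c] unfolding right_perp_def by blast
qed

lemmas left_perp_extension =
  conflation_class.right_perp_extension[OF conflation_class_opposite, simplified]
lemmas left_perp_kernel =
  conflation_class.right_perp_cokernel[OF conflation_class_opposite, simplified]

text \<open>\<open>E\<close>-conflations are \<open>F\<close>-conflations, so orthogonality to
  \<open>Y\<close> in the sense of \<open>F\<close> applies to presentations taken from
  \<open>E\<close>. It enters twice: for \<open>P\<close>, to lift along \<open>b\<close>, and for
  \<open>M\<close>, to extend along \<open>i\<close>.\<close>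

lemma right_perp_relative:
  assumes F: "conflation_class C F" and EF: "E \<subseteq> F" and enough: "enough_projectives C E"
    and proj: "projectives C E \<subseteq> U" and U: "U \<subseteq> Obj C"
    and c: "conflation C F Y Q I a b" and Y: "Y \<in> right_perp C (splits C F) U"
    and I: "I \<in> injectives C E"
  shows "Q \<in> right_perp C (splits C E) U"
proof -
  interpret F: conflation_class C F by (rule F)
  note a = F.conflation_Hom(1)[OF c] and b = F.conflation_Hom(2)[OF c]
  note ob = F.conflation_Hom(3-)[OF c]
  have "splits C E M Q" if M: "M \<in> U" for M
  proof -
    obtain K P i p where e: "conflation C E K P M i p" and P: "P \<in> projectives C E"
      using enough M U unfolding enough_projectives_iff by blast
    note i = conflation_Hom(1)[OF e]
    have eF: "conflation C F K P M i p" using e EF unfolding conflation_def by blast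
    have s: "splits C F P Y" "splits C F M Y" using P proj M Y unfolding right_perp_def by blast+
    show ?thesis
    proof (rule splits_presentation[OF e P])
      fix f assume f: "f \<in> Hom C K Q"
      have bf: "b \<cdot> f \<in> Hom C K I" using f b by (rule Comp_in_Hom)
      obtain g where g: "g \<in> Hom C P I" "g \<cdot> i = b \<cdot> f" using injective_extend[OF I e bf] by blast
      obtain g' where g': "g' \<in> Hom C P Q" "b \<cdot> g' = g" using F.splits_lift[OF s(1) c g(1)] by blast
      have gi: "g' \<cdot> i \<in> Hom C K Q" using i g'(1) by (rule Comp_in_Hom)
      \<comment> \<open>\<open>d\<close> is \<open>f - g' \<cdot> i\<close>, the error of the first
        approximation; \<open>b\<close> kills it, so it comes from \<open>Y\<close>.\<close>
      obtain d where d: "d \<in> Hom C K Q" "d \<boxplus> g' \<cdot> i = f" using difference_exists[OF f gi] by blast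
      have bd: "b \<cdot> d \<in> Hom C K I" using d(1) b by (rule Comp_in_Hom)
      have "b \<cdot> d \<boxplus> b \<cdot> f = b \<cdot> f"
        using Comp_Add[OF d(1) gi b] d(2) Comp_assoc[OF i g'(1) b] g'(2) g(2) by simp
      then have "b \<cdot> d = Zer C K I"
        using Add_right_cancel[OF bd Zer_in_Hom bf] Zer_Add[OF bf] Hom_Obj[OF bf] by simp
      then obtain e where e: "e \<in> Hom C K Y" "a \<cdot> e = d"
        using F.conflation_factor_kernel[OF c d(1)] by blast
      obtain e' where e': "e' \<in> Hom C P Y" "e' \<cdot> i = e"
        using F.splits_extend[OF s(2) eF e(1)] by blast
      have ae: "a \<cdot> e' \<in> Hom C P Q" using e'(1) a by (rule Comp_in_Hom)
      have "(a \<cdot> e' \<boxplus> g') \<cdot> i = f"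
        using Add_Comp[OF i ae g'(1)] Comp_assoc[OF i e'(1) a] e'(2) e(2) d(2) by simp
      then show "\<exists>h\<in>Hom C P Q. h \<cdot> i = f" using Add_in_Hom[OF ae g'(1)] by blast
    qed
  qed
  then show ?thesis using ob unfolding right_perp_def by blast
qed

text \<open>Extension along \<open>j\<close> is possible because the cokernel \<open>X\<close> is in
  \<open>U\<close>, to which every target is orthogonal.\<close>

lemma conflation_preenvelope:
  assumes c: "conflation C E A Q X j q" and X: "X \<in> U" and sub: "subcategory C U"
    and Q: "Q \<in> right_perp C (splits C E) U"
  shows "is_preenvelope C (right_perp C (splits C E) U) A j \<and> is_mono C j \<and> Coker_obj C j \<in> U"
proof (intro conjI)
  note j = conflation_Hom(1)[OF c] and q = conflation_Hom(2)[OF c]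
  have jD: "j \<in> Mor C" "Dom C j = A" "Cod C j = Q" using j by (auto simp: Hom_def)
  have "\<exists>g\<in>Hom C Q V. g \<cdot> j = f" if "V \<in> right_perp C (splits C E) U" "f \<in> Hom C A V" for V f
    using splits_extend[OF _ c that(2)] that(1) X unfolding right_perp_def by blast
  then show "is_preenvelope C (right_perp C (splits C E) U) A j"
    using jD Q unfolding is_preenvelope_def by simp
  show "is_mono C j" unfolding is_mono_def using conflation_monic[OF c] jD by simp
  have "is_cokernel C q j" using c kernel_cokernel
    by (auto simp: conflation_def kernel_cokernel_pairs_def)
  \<comment> \<open>\<open>Coker_obj\<close> is the codomain of an arbitrarily chosen cokernel, so
    it is compared with \<open>X\<close> up to isomorphism.\<close>
  moreover from this have "is_cokernel C (SOME c. is_cokernel C c j) j" by (rule someI)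
  ultimately have "isomorphic C X (Coker_obj C j)"
    using cokernels_iso q unfolding Coker_obj_def isomorphic_def by (fastforce simp: Hom_def)
  then show "Coker_obj C j \<in> U" using X sub unfolding subcategory_def by blast
qed

theorem relative_cotorsion_pair:
  assumes F: "conflation_class C F" and EF: "E \<subseteq> F"
    and enough: "enough_projectives C E" "enough_injectives C E"
    and pair: "is_cotorsion_pair C (splits C F) U V" and complete: "is_complete C F U V"
    and proj: "projectives C E \<subseteq> U"
  defines "W \<equiv> right_perp C (splits C E) U"
  shows "is_cotorsion_pair C (splits C E) U W \<and> is_complete C E U W \<and>
    (\<forall>A\<in>Obj C. \<exists>j. is_preenvelope C W A j \<and> is_mono C j \<and> Coker_obj C j \<in> U)"
proof -
  interpret F: conflation_class C F by (rule F)
  have sub: "subcategory C U" and U: "U = left_perp C (splits C F) V"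
    and V: "V = right_perp C (splits C F) U" using pair unfolding is_cotorsion_pair_def by blast+
  have UO: "U \<subseteq> Obj C" using sub unfolding subcategory_def by blast
  have into: "\<exists>Q X j q. conflation C E A Q X j q \<and> Q \<in> W \<and> X \<in> U" if A: "A \<in> Obj C" for A
  proof -
    obtain I N i p where c: "conflation C E A I N i p" and I: "I \<in> injectives C E"
      using enough(2) A unfolding enough_injectives_iff by metis
    obtain Y X k q where d: "conflation C F Y X N k q" and YX: "Y \<in> V" "X \<in> U"
      using complete conflation_Hom(5)[OF c] unfolding F.is_complete_iff by blast
    obtain Q i' p' k' q' where "conflation C E A Q X i' p'" "conflation C F Y Q I k' q'"
      using pullback_conflations[OF F c d] by blast
    with right_perp_relative[OF F EF enough(1) proj UO] YX I V show ?thesis unfolding W_def by blast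
  qed
  \<comment> \<open>Salce's trick: embed the kernel \<open>K\<close> of a projective presentation of
    \<open>M\<close> by \<open>into\<close> and push out. The middle term \<open>Q\<close> is then
    an extension of \<open>X\<close> by \<open>P\<close>, and \<open>U\<close>, a left orthogonal
    for \<open>F\<close>, is closed under extensions in \<open>F\<close>.\<close>
  have onto: "\<exists>L Q i p. conflation C E L Q M i p \<and> L \<in> W \<and> Q \<in> U" if M: "M \<in> Obj C" for M
  proof -
    obtain K P i p where c: "conflation C E K P M i p" and P: "P \<in> projectives C E"
      using enough(1) M unfolding enough_projectives_iff by blast
    obtain L X j q where d: "conflation C E K L X j q" "L \<in> W" "X \<in> U"
      using into conflation_Hom(3)[OF c] by blast
    obtain Q i' p' j' q' where e: "conflation C E L Q M i' p'" "conflation C E P Q X j' q'"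
      using pushout_conflations[OF conflation_class_axioms c d(1)] by blast
    have "conflation C F P Q X j' q'" using e(2) EF unfolding conflation_def by blast
    then have "Q \<in> U" using F.left_perp_extension P proj d(3) U by blast
    with e(1) d(2) show ?thesis by blast
  qed
  have complete': "is_complete C E U W" unfolding is_complete_iff using into onto by blast
  have "U = left_perp C (splits C E) W"
  proof
    show "U \<subseteq> left_perp C (splits C E) W" using UO unfolding left_perp_def right_perp_def W_def by blast
    show "left_perp C (splits C E) W \<subseteq> U"
    proof
      fix M assume M: "M \<in> left_perp C (splits C E) W"
      then obtain L Q i p where c: "conflation C E L Q M i p" and LQ: "L \<in> W" "Q \<in> U"
        using onto unfolding left_perp_def by blast
      \<comment> \<open>\<open>Q \<rightarrow> M\<close> splits, so \<open>M\<close> is a direct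
        summand of \<open>Q\<close>; \<open>subcategory\<close> speaks of the first summand, hence
        the exchange of the two below.\<close>
      then have "splits C E M L" using M unfolding left_perp_def by blast
      then obtain r where "r \<in> Hom C Q L" "r \<cdot> i = Id C L" using c unfolding splits_def by blast
      from retraction_biproduct[OF c this] obtain s where "is_biproduct C L M Q i s r p" by blast
      then have "is_biproduct C M L Q s i p r"
        using Add_commute Comp_in_Hom unfolding is_biproduct_def by metis
      then show "M \<in> U" using sub LQ(2) unfolding subcategory_def is_direct_sum_def by blast
    qed
  qed
  then have "is_cotorsion_pair C (splits C E) U W"
    using sub subcategory_right_perp unfolding is_cotorsion_pair_def W_def by blast
  moreover have "\<exists>j. is_preenvelope C W A j \<and> is_mono C j \<and> Coker_obj C j \<in> U" if "A \<in> Obj C" for A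
    using into[OF that] conflation_preenvelope[OF _ _ sub] unfolding W_def by blast
  ultimately show ?thesis using complete' by blast
qed

end


section \<open>Vanishing of the Ext groups\<close>

lemma (in comm_group) trivial_subgroup_quotient_iff:
  assumes I: "subgroup I G" and J: "subgroup J G" and IJ: "I \<subseteq> J"
  shows "trivial_group (G\<lparr>carrier := J\<rparr> Mod I) \<longleftrightarrow> J \<subseteq> I"
proof -
  let ?J = "G\<lparr>carrier := J\<rparr>"
  have "group ?J" using J by (rule subgroup_imp_group)
  \<comment> \<open>Commutativity makes \<open>I\<close> normal in \<open>J\<close>, so that the
    quotient is a group; its neutral element is the coset \<open>I\<close>.\<close>
  then interpret J: comm_group ?J
    using subgroup.subset[OF J] m_comm by (intro group.group_comm_groupI) auto
  have sub: "subgroup I ?J" using I J IJ by (rule subgroup_incl)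
  have carrier: "carrier (?J Mod I) = (\<lambda>x. I #>\<^bsub>?J\<^esub> x) ` J" by (simp add: carrier_FactGroup)
  show ?thesis
  proof
    assume "trivial_group (?J Mod I)"
    then have "I #>\<^bsub>?J\<^esub> x = I" if "x \<in> J" for x
      using that carrier by (auto simp: trivial_group_def)
    then show "J \<subseteq> I" using J.coset_join1[OF _ _ sub] by auto
  next
    assume "J \<subseteq> I"
    then have "I #>\<^bsub>?J\<^esub> x = I" if "x \<in> J" for x using J.coset_join2[OF _ sub] that by auto
    moreover have "J \<noteq> {}" using subgroup.one_closed[OF J] by blast
    ultimately have "carrier (?J Mod I) = {I}" unfolding carrier by auto
    then show "trivial_group (?J Mod I)"
      using comm_group.axioms(2)[OF J.abelian_FactGroup[OF sub]] by (simp add: trivial_group_def)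
  qed
qed

section \<open>Comparison of both Ext groups with the splitting of extensions\<close>

context conflation_class
begin

text \<open>Iterate a chosen presentation, each time applied to the kernel obtained before.\<close>

lemma projective_resolution_exists:
  assumes enough: "enough_projectives C E" and M: "M \<in> Obj C"
  shows "\<exists>r. projective_resolution C E M r"
proof -
  have "\<exists>c. c \<in> E \<and> Dom C (snd c) \<in> projectives C E \<and> Cod C (snd c) = N" if "N \<in> Obj C" for N
    using enough that unfolding enough_projectives_def admissible_epic_def by force
  then obtain F where F: "\<And>N. N \<in> Obj C \<Longrightarrow>
      F N \<in> E \<and> Dom C (snd (F N)) \<in> projectives C E \<and> Cod C (snd (F N)) = N"
    by metis
  define r where "r = rec_nat (F M) (\<lambda>_ c. F (Dom C (fst c)))"
  have r0: "r 0 = F M" and rS: "r (Suc n) = F (Dom C (fst (r n)))" for n by (simp_all add: r_def)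
  have DomE: "Dom C (fst c) \<in> Obj C" if "c \<in> E" for c
    using conflation_Hom(3)[OF conflationI] that by (metis prod.collapse)
  \<comment> \<open>Membership in \<open>E\<close> comes first: it makes each kernel an object, to
    which the choice \<open>F\<close> applies.\<close>
  have "r n \<in> E" for n
    by (induction n) (use F M DomE in \<open>auto simp: r0 rS\<close>)
  then have ob: "Dom C (fst (r n)) \<in> Obj C" for n using DomE by blast
  have "r n \<in> E \<and> Dom C (snd (r n)) \<in> projectives C E" for n
    using F[OF M] F[OF ob] by (cases n) (simp_all add: r0 rS)
  then show ?thesis using F[OF M] F[OF ob] unfolding projective_resolution_def
    by (intro exI[of _ r]) (simp add: r0 rS)
qed

text \<open>The cocycles in degree \<open>1\<close> are the maps \<open>P 1 \<rightarrow> N\<close> factoring through \<open>K 1\<close>, and the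
  coboundaries those whose factorization extends along \<open>K 1 \<rightarrow> P 0\<close>.\<close>

lemma rel_Ext1_vanishes_iff_splits:
  assumes enough: "enough_projectives C E" and M: "M \<in> Obj C" and N: "N \<in> Obj C"
  shows "rel_Ext1_vanishes C E M N \<longleftrightarrow> splits C E M N"
proof -
  define r where "r = (SOME r. projective_resolution C E M r)"
  have r: "projective_resolution C E M r"
    unfolding r_def using projective_resolution_exists[OF enough M] by (rule someI_ex)
  \<comment> \<open>By the shift in \<open>res_diff\<close> the differentials in degrees 1 and 2 are
    \<open>i0 \<cdot> p1\<close> and \<open>i1 \<cdot> p2\<close>, so degree 1 involves just the
    first three conflations.\<close>
  obtain i0 p0 i1 p1 i2 p2 where rr: "r 0 = (i0, p0)" "r (Suc 0) = (i1, p1)" "r (Suc (Suc 0)) = (i2, p2)"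
    by (metis prod.exhaust)
  have rE: "r n \<in> E" and rP: "Dom C (snd (r n)) \<in> projectives C E"
    and rS: "Cod C (snd (r (Suc n))) = Dom C (fst (r n))" and rM: "Cod C (snd (r 0)) = M" for n
    using r unfolding projective_resolution_def by blast+
  define K1 P0 K2 P1 K3 P2 where defs: "K1 = Dom C i0" "P0 = Dom C p0" "K2 = Dom C i1"
    "P1 = Dom C p1" "K3 = Dom C i2" "P2 = Dom C p2"
  have cc: "conflation C E (Dom C i) (Dom C p) (Cod C p) i p" if "(i, p) \<in> E" for i p
    using conflationI[OF that] by (simp add: conflation_def Hom_def)
  have c0: "conflation C E K1 P0 M i0 p0" and c1: "conflation C E K2 P1 K1 i1 p1"
    and c2: "conflation C E K3 P2 K2 i2 p2"
    using cc rE[of 0] rE[of "Suc 0"] rE[of "Suc (Suc 0)"] rS[of 0] rS[of "Suc 0"] rM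
    by (fastforce simp: rr defs)+
  have P0: "P0 \<in> projectives C E" using rP[of 0] by (simp add: rr defs)
  note i0 = conflation_Hom(1)[OF c0] and p1 = conflation_Hom(2)[OF c1]
    and i1 = conflation_Hom(1)[OF c1] and p2 = conflation_Hom(2)[OF c2]
  note ob = conflation_Hom(3-)[OF c0] conflation_Hom(3-)[OF c1] conflation_Hom(3-)[OF c2]
  have ip: "i0 \<cdot> p1 \<in> Hom C P1 P0" using p1 i0 by (rule Comp_in_Hom)
  have cob: "coboundaries C r 1 N = (\<lambda>g. g \<cdot> (i0 \<cdot> p1)) ` Hom C P0 N"
    by (simp add: coboundaries_def res_diff_def res_obj_def rr defs)
  have "cocycles C r 1 N = {f \<in> Hom C P1 N. f \<cdot> (i1 \<cdot> p2) = Zer C P2 N}"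
    by (simp add: cocycles_def res_diff_def res_obj_def rr defs)
  \<comment> \<open>Cancelling the epic \<open>p2\<close>, a cocycle is a morphism that kills
    \<open>i1\<close>, i.e. one that factors through \<open>p1\<close>.\<close>
  also have "\<dots> = (\<lambda>h. h \<cdot> p1) ` Hom C K1 N"
  proof (intro equalityI subsetI)
    fix f assume "f \<in> {f \<in> Hom C P1 N. f \<cdot> (i1 \<cdot> p2) = Zer C P2 N}"
    then have f: "f \<in> Hom C P1 N" "(f \<cdot> i1) \<cdot> p2 = Zer C K2 N \<cdot> p2"
      using Comp_assoc[OF p2 i1] Zer_Comp[OF p2 N] by auto
    have "f \<cdot> i1 = Zer C K2 N"
      using conflation_epic[OF c2 Comp_in_Hom[OF i1 f(1)] Zer_in_Hom] f(2) N ob by simp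
    then show "f \<in> (\<lambda>h. h \<cdot> p1) ` Hom C K1 N"
      using conflation_factor_cokernel[OF c1 f(1)] by auto
  next
    fix f assume "f \<in> (\<lambda>h. h \<cdot> p1) ` Hom C K1 N"
    then obtain h where h: "h \<in> Hom C K1 N" "f = h \<cdot> p1" by blast
    have f: "f \<in> Hom C P1 N" using Comp_in_Hom[OF p1 h(1)] h(2) by simp
    have "f \<cdot> i1 = Zer C K2 N"
      using Comp_assoc[OF i1 p1 h(1)] h(2) conflation_zero[OF c1] Comp_Zer[OF h(1)] ob by simp
    then have "f \<cdot> (i1 \<cdot> p2) = Zer C P2 N"
      using Comp_assoc[OF p2 i1 f] Zer_Comp[OF p2 N] by simp
    with f show "f \<in> {f \<in> Hom C P1 N. f \<cdot> (i1 \<cdot> p2) = Zer C P2 N}" by blast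
  qed
  finally have coc: "cocycles C r 1 N = (\<lambda>h. h \<cdot> p1) ` Hom C K1 N" .
  have carrier: "Hom C A N = carrier (Hom_group C A N)" for A by (simp add: Hom_group_def)
  have obj: "res_obj C r 1 = P1" by (simp add: res_obj_def rr defs)
  have "subgroup (cocycles C r 1 N) (Hom_group C P1 N)"
    "subgroup (coboundaries C r 1 N) (Hom_group C P1 N)"
    unfolding coc cob carrier
    using group_hom.img_is_subgroup[OF precomposition_group_hom[OF p1 N]]
      group_hom.img_is_subgroup[OF precomposition_group_hom[OF ip N]] by simp_all
  moreover have assoc: "g \<cdot> (i0 \<cdot> p1) = (g \<cdot> i0) \<cdot> p1" if "g \<in> Hom C P0 N" for g
    using Comp_assoc[OF p1 i0 that] by simp
  then have "coboundaries C r 1 N \<subseteq> cocycles C r 1 N"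
    unfolding coc cob using Comp_in_Hom[OF i0] by blast
  ultimately have "rel_Ext1_vanishes C E M N \<longleftrightarrow> cocycles C r 1 N \<subseteq> coboundaries C r 1 N"
    unfolding rel_Ext1_vanishes_def rel_Ext_def res_cohomology_def r_def[symmetric] obj
    by (intro comm_group.trivial_subgroup_quotient_iff[OF Hom_comm_group]) (use ob N in auto)
  \<comment> \<open>Since \<open>p1\<close> is epic, factorizations through \<open>K1\<close> are
    unique and the condition moves from \<open>P1\<close> to \<open>K1\<close>.\<close>
  also have "\<dots> \<longleftrightarrow> (\<forall>h\<in>Hom C K1 N. \<exists>g\<in>Hom C P0 N. g \<cdot> i0 = h)"
  proof
    assume sub: "cocycles C r 1 N \<subseteq> coboundaries C r 1 N"
    show "\<forall>h\<in>Hom C K1 N. \<exists>g\<in>Hom C P0 N. g \<cdot> i0 = h"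
    proof
      fix h assume h: "h \<in> Hom C K1 N"
      then obtain g where g: "g \<in> Hom C P0 N" "h \<cdot> p1 = (g \<cdot> i0) \<cdot> p1"
        using sub assoc unfolding coc cob by fastforce
      then have "g \<cdot> i0 = h"
        using conflation_epic[OF c1 h Comp_in_Hom[OF i0 g(1)]] by simp
      with g(1) show "\<exists>g\<in>Hom C P0 N. g \<cdot> i0 = h" by blast
    qed
  qed (use assoc in \<open>unfold coc cob, fastforce\<close>)
  also have "\<dots> \<longleftrightarrow> splits C E M N"
    using splits_presentation[OF c0 P0] splits_extend[OF _ c0] by blast
  finally show ?thesis .
qed

text \<open>If all extensions split, then every single one of them is a biproduct extension, and so
  there is just one class.\<close>

lemma Ext1_vanishes_iff_splits:
  assumes E: "E = short_exact_sequences C" and sum: "\<exists>S. is_direct_sum C N M S"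
    and M: "M \<in> Obj C" and N: "N \<in> Obj C"
  shows "Ext1_vanishes C M N \<longleftrightarrow> splits C E M N"
proof -
  have ext: "(i, p) \<in> extensions C M N \<longleftrightarrow> (\<exists>T. conflation C E N T M i p)" for i p
    using conflationI[of i p] unfolding extensions_def E by (auto simp: conflation_def Hom_def)
  show ?thesis
  proof
    assume v: "Ext1_vanishes C M N"
    show "splits C E M N" unfolding splits_def
    proof (intro allI impI)
      fix T i p assume c: "conflation C E N T M i p"
      note i = conflation_Hom(1)[OF c] and p = conflation_Hom(2)[OF c] and ob = conflation_Hom(3-)[OF c]
      have ip: "(i, p) \<in> extensions C M N" using c ext by blast
      \<comment> \<open>Reflexivity places \<open>(i, p)\<close> in its own class; as this is the
        zero class, the extension is equivalent to a biproduct.\<close>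
      have "is_iso C (Id C T)" using Id_in_Hom[OF ob(2)] Id_Comp[OF Id_in_Hom[OF ob(2)]]
        unfolding is_iso_def Hom_def by auto
      then have "((i, p), (i, p)) \<in> extension_equiv C M N"
        using ip Id_Comp[OF i] Comp_Id[OF p] Id_in_Hom[OF ob(2)] i unfolding extension_equiv_def Hom_def
        by auto
      moreover have "extension_equiv C M N `` {(i, p)} = Ext1_zero C M N"
        using quotientI[OF ip, of "extension_equiv C M N"] v unfolding Ext1_vanishes_def Ext1_def
        by simp
      ultimately obtain i' p' S b a where S: "is_biproduct C N M S i' b a p'"
        and eq: "((i', p'), (i, p)) \<in> extension_equiv C M N"
        unfolding Ext1_zero_def by blast
      then obtain \<phi> where \<phi>: "\<phi> \<in> Hom C (Cod C i') (Cod C i)" "is_iso C \<phi>" "\<phi> \<cdot> i' = i"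
        unfolding extension_equiv_def by blast
      have i': "i' \<in> Hom C N S" and a: "a \<in> Hom C S N" "a \<cdot> i' = Id C N"
        using S unfolding is_biproduct_def by blast+
      have \<phi>': "\<phi> \<in> Hom C S T" using \<phi>(1) i i' by (simp add: Hom_def)
      \<comment> \<open>The retraction is the projection \<open>a\<close> transported along the
        inverse \<open>\<psi>\<close>.\<close>
      obtain \<psi> where \<psi>: "\<psi> \<in> Hom C T S" "\<psi> \<cdot> \<phi> = Id C S"
        using \<phi>(2) \<phi>' unfolding is_iso_def by (auto simp: Hom_def)
      have "\<psi> \<cdot> i = i'" using Comp_assoc[OF i' \<phi>' \<psi>(1)] \<psi>(2) \<phi>(3) Id_Comp[OF i'] by simp
      then have "(a \<cdot> \<psi>) \<cdot> i = Id C N" using Comp_assoc[OF i \<psi>(1) a(1)] a(2) by simp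
      then show "\<exists>r\<in>Hom C T N. r \<cdot> i = Id C N" using Comp_in_Hom[OF \<psi>(1) a(1)] by blast
    qed
  next
    assume s: "splits C E M N"
    have bip: "\<exists>T b a. is_biproduct C N M T i b a p" if "(i, p) \<in> extensions C M N" for i p
    proof -
      obtain T where c: "conflation C E N T M i p" using ext \<open>(i, p) \<in> extensions C M N\<close> by blast
      with s obtain r where "r \<in> Hom C T N" "r \<cdot> i = Id C N" unfolding splits_def by blast
      from retraction_biproduct[OF c this] show ?thesis by blast
    qed
    have equiv: "((i, p), (i', p')) \<in> extension_equiv C M N"
      if ip: "(i, p) \<in> extensions C M N" and ip': "(i', p') \<in> extensions C M N" for i p i' p'
    proof -
      obtain T b a where T: "is_biproduct C N M T i b a p" using bip[OF ip] by blast
      obtain T' b' a' where T': "is_biproduct C N M T' i' b' a' p'" using bip[OF ip'] by blast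
      have "Cod C i = T" "Cod C i' = T'"
        using biproduct_Hom(1)[OF T] biproduct_Hom(1)[OF T'] by (auto simp: Hom_def)
      with biproducts_iso[OF T T'] ip ip' show ?thesis unfolding extension_equiv_def by blast
    qed
    have bip_ext: "(i, p) \<in> extensions C M N" if "is_biproduct C N M T i b a p" for i p T b a
      using biproduct_kernel[OF that] biproduct_cokernel[OF that] biproduct_Hom[OF that]
      by (auto simp: extensions_def kernel_cokernel_pairs_def Hom_def)
    have eq: "extension_equiv C M N = extensions C M N \<times> extensions C M N"
      using equiv by (auto simp: extension_equiv_def)
    \<comment> \<open>A direct sum guarantees that there is an extension at all; the quotient of the
      empty set would be empty instead of a singleton.\<close>
    obtain S i b a p where S: "is_biproduct C N M S i b a p"
      using sum unfolding is_direct_sum_def by blast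
    have "Ext1 C M N = {extensions C M N}"
      using bip_ext[OF S] unfolding Ext1_def eq quotient_def by auto
    moreover have "Ext1_zero C M N = extensions C M N"
      using bip_ext[OF S] bip_ext S unfolding Ext1_zero_def eq by blast
    ultimately show "Ext1_vanishes C M N" unfolding Ext1_vanishes_def by simp
  qed
qed

end


section \<open>Exact structures and short exact sequences\<close>

context preadditive_category
begin

lemma is_iso_Id: assumes "A \<in> Obj C" shows "is_iso C (Id C A)"
  using Id_in_Hom[OF assms] Id_Comp[OF Id_in_Hom[OF assms]] unfolding is_iso_def Hom_def by auto

lemma kernels_iso:
  assumes "is_kernel C k f" "is_kernel C l f"
  shows "\<exists>a\<in>Hom C (Dom C k) (Dom C l). is_iso C a \<and> l \<cdot> a = k"
  using preadditive_category.axioms(1)[OF preadditive_category_opposite, THEN category.cokernels_iso, of l f k]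
    assms by simp

text \<open>Closure under isomorphic pairs permits exchanging one cokernel or kernel for another, by
  an isomorphism of pairs that is the identity on the other two objects.\<close>

lemma exact_structure_conflation_class:
  assumes ex: "exact_structure C E" shows "conflation_class C E"
proof -
  from ex[unfolded exact_structure_def] have kc: "E \<subseteq> kernel_cokernel_pairs C"
    and iso_all: "\<forall>i p i' p'. (i, p) \<in> E \<and> i' \<in> Mor C \<and> p' \<in> Mor C \<and> Cod C i' = Dom C p' \<and>
      iso_pairs C (i, p) (i', p') \<longrightarrow> (i', p') \<in> E"
    and monic: "\<forall>i j. admissible_monic E i \<and> admissible_monic E j \<and> Cod C i = Dom C j \<longrightarrow>
      admissible_monic E (j \<cdot> i)"
    and epic: "\<forall>p q. admissible_epic E p \<and> admissible_epic E q \<and> Cod C p = Dom C q \<longrightarrow>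
      admissible_epic E (q \<cdot> p)"
    and po: "\<forall>i f. admissible_monic E i \<and> f \<in> Mor C \<and> Dom C f = Dom C i \<longrightarrow>
        (\<exists>i' f'. is_pushout C i f i' f') \<and>
        (\<forall>i' f'. is_pushout C i f i' f' \<longrightarrow> admissible_monic E i')"
    and pb: "\<forall>p f. admissible_epic E p \<and> f \<in> Mor C \<and> Cod C f = Cod C p \<longrightarrow>
        (\<exists>p' f'. is_pullback C p f p' f') \<and>
        (\<forall>p' f'. is_pullback C p f p' f' \<longrightarrow> admissible_epic E p')"
    by - (elim conjE, assumption)+
  have iso: "\<lbrakk>(i, p) \<in> E; i' \<in> Mor C; p' \<in> Mor C; Cod C i' = Dom C p';
      iso_pairs C (i, p) (i', p')\<rbrakk> \<Longrightarrow> (i', p') \<in> E" for i p i' p'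
    using iso_all by blast
  show ?thesis
  proof
    show "E \<subseteq> kernel_cokernel_pairs C" by (rule kc)
    show "(i, p') \<in> E" if ip: "(i, p) \<in> E" and p': "is_cokernel C p' i" for i p p'
    proof (rule iso[OF ip])
      have p: "is_cokernel C p i" using kc ip by (auto simp: kernel_cokernel_pairs_def)
      have ty: "i \<in> Hom C (Dom C i) (Cod C i)" "p' \<in> Mor C" "p' \<in> Hom C (Cod C i) (Cod C p')"
        using p' by (auto simp: is_cokernel_def Hom_def)
      then show "i \<in> Mor C" "p' \<in> Mor C" "Cod C i = Dom C p'" by (auto simp: Hom_def)
      obtain c where c: "c \<in> Hom C (Cod C p) (Cod C p')" "is_iso C c" "c \<cdot> p = p'"
        using cokernels_iso[OF p p'] by blast
      note ob = Hom_Obj[OF ty(1)]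
      show "iso_pairs C (i, p) (i, p')" unfolding iso_pairs_def prod.case
        by (intro exI[of _ "Id C (Dom C i)"] exI[of _ "Id C (Cod C i)"] exI[of _ c])
          (simp add: is_iso_Id Id_in_Hom ob Id_Comp[OF ty(1)] Comp_Id[OF ty(1)] Comp_Id[OF ty(3)] c)
    qed
    show "(i', p) \<in> E" if ip: "(i, p) \<in> E" and i': "is_kernel C i' p" for i p i'
    proof (rule iso[OF ip])
      have i: "is_kernel C i p" using kc ip by (auto simp: kernel_cokernel_pairs_def)
      have ty: "p \<in> Hom C (Dom C p) (Cod C p)" "i' \<in> Mor C" "i \<in> Hom C (Dom C i) (Dom C p)"
        "Cod C i' = Dom C p" "Cod C i = Dom C p"
        using i i' by (auto simp: is_kernel_def Hom_def)
      then show "i' \<in> Mor C" "p \<in> Mor C" "Cod C i' = Dom C p" by (auto simp: Hom_def)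
      obtain a where a: "a \<in> Hom C (Dom C i) (Dom C i')" "is_iso C a" "i' \<cdot> a = i"
        using kernels_iso[OF i i'] by blast
      note ob = Hom_Obj[OF ty(1)]
      show "iso_pairs C (i, p) (i', p)" unfolding iso_pairs_def prod.case
        by (intro exI[of _ a] exI[of _ "Id C (Cod C i)"] exI[of _ "Id C (Cod C p)"])
          (simp add: is_iso_Id Id_in_Hom ob Id_Comp[OF ty(1)] Comp_Id[OF ty(1)] Id_Comp[OF ty(3)] a ty(4,5))
    qed
    show "\<exists>i' f'. is_pushout C i f i' f'"
      if "admissible_monic E i" "f \<in> Mor C" "Dom C f = Dom C i" for i f
      using that po by blast
    show "admissible_monic E i'" if i: "admissible_monic E i" and sq: "is_pushout C i f i' f'" for i f i' f'
    proof -
      have "f \<in> Mor C" "Dom C f = Dom C i" using sq unfolding is_pushout_def by simp_all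
      with po i sq show ?thesis by blast
    qed
    show "\<exists>p' f'. is_pullback C p f p' f'"
      if "admissible_epic E p" "f \<in> Mor C" "Cod C f = Cod C p" for p f
      using that pb by blast
    show "admissible_epic E p'" if p: "admissible_epic E p" and sq: "is_pullback C p f p' f'" for p f p' f'
    proof -
      have "f \<in> Mor C" "Cod C f = Cod C p" using sq unfolding is_pullback_def by simp_all
      with pb p sq show ?thesis by blast
    qed
  qed (use monic epic in blast)+
qed

section \<open>Monomorphisms and kernels\<close>

lemma is_mono_iff:
  assumes "f \<in> Hom C A B"
  shows "is_mono C f \<longleftrightarrow> (\<forall>T. \<forall>g\<in>Hom C T A. f \<cdot> g = Zer C T B \<longrightarrow> g = Zer C T A)"
proof
  assume m: "is_mono C f"
  show "\<forall>T. \<forall>g\<in>Hom C T A. f \<cdot> g = Zer C T B \<longrightarrow> g = Zer C T A"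
  proof (intro allI ballI impI)
    fix T g assume g: "g \<in> Hom C T A" "f \<cdot> g = Zer C T B"
    then have "f \<cdot> g = f \<cdot> Zer C T A" using Comp_Zer[OF assms] Hom_Obj[OF g(1)] by simp
    moreover have "Zer C T A \<in> Hom C T A" using Zer_in_Hom Hom_Obj[OF g(1)] by simp
    moreover have "Dom C f = A" using assms by (simp add: Hom_def)
    ultimately show "g = Zer C T A" using m g(1) unfolding is_mono_def by metis
  qed
next
  assume z: "\<forall>T. \<forall>g\<in>Hom C T A. f \<cdot> g = Zer C T B \<longrightarrow> g = Zer C T A"
  have "g = h" if g: "g \<in> Hom C T A" and h: "h \<in> Hom C T A" and eq: "f \<cdot> g = f \<cdot> h" for T g h
  proof -
    obtain d where d: "d \<in> Hom C T A" "d \<boxplus> h = g" using difference_exists[OF g h] by blast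
    have fh: "f \<cdot> h \<in> Hom C T B" and fd: "f \<cdot> d \<in> Hom C T B" using h d assms Comp_in_Hom by blast+
    have "f \<cdot> d \<boxplus> f \<cdot> h = f \<cdot> h" using Comp_Add[OF d(1) h assms] d(2) eq by simp
    then have "f \<cdot> d = Zer C T B"
      using Add_right_cancel[OF fd Zer_in_Hom fh] Zer_Add[OF fh] Hom_Obj[OF fh] by simp
    with z d show "g = h" using Zer_Add[OF h] by auto
  qed
  then show "is_mono C f" using assms unfolding is_mono_def by (auto simp: Hom_def)
qed

lemma is_mono_Comp:
  assumes "is_mono C f" "is_mono C g" "Cod C f = Dom C g" shows "is_mono C (g \<cdot> f)"
proof -
  have f: "f \<in> Hom C (Dom C f) (Dom C g)" and g: "g \<in> Hom C (Dom C g) (Cod C g)"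
    using assms unfolding is_mono_def Hom_def by auto
  show ?thesis
    using assms(1,2) Comp_in_Hom[OF _ f] Comp_assoc[OF _ f g]
    unfolding is_mono_iff[OF f] is_mono_iff[OF g] is_mono_iff[OF Comp_in_Hom[OF f g]] by auto
qed

lemma is_mono_cancel:
  assumes f: "f \<in> Hom C A B" and g: "g \<in> Hom C B D" and m: "is_mono C (g \<cdot> f)"
  shows "is_mono C f"
  unfolding is_mono_iff[OF f]
proof (intro allI ballI impI)
  fix T h assume h: "h \<in> Hom C T A" "f \<cdot> h = Zer C T B"
  have "(g \<cdot> f) \<cdot> h = Zer C T D"
    using Comp_assoc[OF h(1) f g] h(2) Comp_Zer[OF g] Hom_Obj[OF h(1)] by simp
  with m h(1) show "h = Zer C T A" unfolding is_mono_iff[OF Comp_in_Hom[OF f g]] by blast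
qed

lemma kernel_is_mono:
  assumes "is_kernel C k f" shows "is_mono C k"
proof -
  have k: "k \<in> Hom C (Dom C k) (Dom C f)" and f: "f \<in> Hom C (Dom C f) (Cod C f)"
    and fk: "f \<cdot> k = Zer C (Dom C k) (Cod C f)"
    and uniq: "\<And>A g. \<lbrakk>g \<in> Hom C A (Dom C f); f \<cdot> g = Zer C A (Cod C f)\<rbrakk>
      \<Longrightarrow> \<exists>!h. h \<in> Hom C A (Dom C k) \<and> k \<cdot> h = g"
    using assms unfolding is_kernel_def by (auto simp: Hom_def)
  show ?thesis unfolding is_mono_iff[OF k]
  proof (intro allI ballI impI)
    fix T g assume g: "g \<in> Hom C T (Dom C k)" "k \<cdot> g = Zer C T (Dom C f)"
    have z: "Zer C T (Dom C f) \<in> Hom C T (Dom C f)" "Zer C T (Dom C k) \<in> Hom C T (Dom C k)"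
      using Zer_in_Hom Hom_Obj[OF g(1)] Hom_Obj[OF f] by blast+
    have "f \<cdot> Zer C T (Dom C f) = Zer C T (Cod C f)" "k \<cdot> Zer C T (Dom C k) = Zer C T (Dom C f)"
      using Comp_Zer[OF f] Comp_Zer[OF k] Hom_Obj[OF g(1)] by simp_all
    then show "g = Zer C T (Dom C k)" using uniq[OF z(1)] z(2) g by blast
  qed
qed

end

section \<open>The short exact sequences of an abelian category\<close>

context abelian_category
begin

lemma abelian_category_opposite: "abelian_category (opposite C)"
proof -
  interpret opp: preadditive_category "opposite C" by (rule preadditive_category_opposite)
  show ?thesis
    by unfold_locales (simp_all add: zero_object direct_sums kernels cokernels mono_normal epi_normal)
qed

text \<open>\<open>i\<close> is the kernel of some \<open>g\<close>, and \<open>g\<close> factors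
  through the cokernel \<open>p\<close>; hence every morphism killed by \<open>p\<close> is killed
  by \<open>g\<close> and factors through \<open>i\<close>.\<close>

lemma mono_kernel_cokernel:
  assumes m: "is_mono C i" and c: "is_cokernel C p i"
  shows "is_kernel C i p"
proof -
  obtain g where g: "is_kernel C i g" using mono_normal[OF m] by blast
  have i: "i \<in> Hom C (Dom C i) (Cod C i)" and p: "p \<in> Hom C (Cod C i) (Cod C p)"
    using c by (auto simp: is_cokernel_def Hom_def)
  have gH: "g \<in> Hom C (Cod C i) (Cod C g)" using g by (auto simp: is_kernel_def Hom_def)
  note g' = g[unfolded is_kernel_iff[OF i gH]] and c' = c[unfolded is_cokernel_iff[OF i p]]
  obtain h where h: "h \<in> Hom C (Cod C p) (Cod C g)" "h \<cdot> p = g" using c' g' gH by blast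
  have "\<exists>!x. x \<in> Hom C A (Dom C i) \<and> i \<cdot> x = t"
    if t: "t \<in> Hom C A (Cod C i)" "p \<cdot> t = Zer C A (Cod C p)" for A t
  proof -
    have "g \<cdot> t = Zer C A (Cod C g)"
      using Comp_assoc[OF t(1) p h(1)] h(2) t(2) Comp_Zer[OF h(1)] Hom_Obj[OF t(1)] by simp
    with g' t(1) show ?thesis by blast
  qed
  with c' show ?thesis unfolding is_kernel_iff[OF i p] by blast
qed

lemma admissible_monic_iff_mono: "admissible_monic (short_exact_sequences C) i \<longleftrightarrow> is_mono C i"
proof
  assume m: "is_mono C i"
  then obtain p where "is_cokernel C p i" using cokernels unfolding is_mono_def by blast
  with mono_kernel_cokernel[OF m] show "admissible_monic (short_exact_sequences C) i"
    unfolding admissible_monic_def kernel_cokernel_pairs_def by blast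
qed (auto simp: admissible_monic_def kernel_cokernel_pairs_def intro: kernel_is_mono)

text \<open>The push-out is the cokernel of \<open>n = b \<cdot> i - a \<cdot> f\<close> from
  \<open>L\<close> to the direct sum of \<open>K\<close> and \<open>M\<close>; composing with the
  projection to \<open>M\<close> shows that \<open>n\<close> is a monomorphism.\<close>

lemma mono_pushout_exists:
  assumes m: "is_mono C i" and i: "i \<in> Hom C L M" and f: "f \<in> Hom C L K"
  shows "\<exists>i' f'. is_pushout C i f i' f' \<and> is_mono C i'"
proof -
  note ob = Hom_Obj[OF i] Hom_Obj[OF f]
  obtain S a b x y where S: "is_biproduct C K M S a b x y"
    using direct_sums[OF ob(4,2)] unfolding is_direct_sum_def by blast
  note SH = biproduct_Hom[OF S]
  have af: "a \<cdot> f \<in> Hom C L S" and bi: "b \<cdot> i \<in> Hom C L S" using SH i f Comp_in_Hom by blast+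
  obtain n where n: "n \<in> Hom C L S" "n \<boxplus> a \<cdot> f = b \<cdot> i" using difference_exists[OF bi af] by blast
  have yn: "y \<cdot> n \<in> Hom C L M" using n(1) SH(4) by (rule Comp_in_Hom)
  have "y \<cdot> n = i"
    using Comp_Add[OF n(1) af SH(4)] n(2) Comp_assoc[OF f SH(1,4)] Comp_assoc[OF i SH(2,4)] SH(6,8)
      Zer_Comp[OF f] Id_Comp[OF i] Zer_Add[OF yn] ob by simp
  then have mn: "is_mono C n" using is_mono_cancel[OF n(1) SH(4)] m by simp
  have "n \<in> Mor C" using n(1) by (simp add: Hom_def)
  then obtain c where c: "is_cokernel C c n" using cokernels by blast
  define Q where "Q = Cod C c"
  have cH: "c \<in> Hom C S Q" using c n(1) by (auto simp: is_cokernel_def Hom_def Q_def)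
  have k: "is_kernel C n c" using mono_kernel_cokernel[OF mn c] .
  note c' = c[unfolded is_cokernel_iff[OF n(1) cH]] and k' = k[unfolded is_kernel_iff[OF n(1) cH]]
  have ca: "c \<cdot> a \<in> Hom C K Q" and cb: "c \<cdot> b \<in> Hom C M Q" using SH cH Comp_in_Hom by blast+
  have caf: "c \<cdot> (a \<cdot> f) \<in> Hom C L Q" using af cH by (rule Comp_in_Hom)
  have "c \<cdot> (a \<cdot> f) = c \<cdot> (b \<cdot> i)" using Comp_Add[OF n(1) af cH] n(2) c' Zer_Add[OF caf] by simp
  then have comm: "(c \<cdot> b) \<cdot> i = (c \<cdot> a) \<cdot> f"
    using Comp_assoc[OF i SH(2) cH] Comp_assoc[OF f SH(1) cH] by simp
  have "\<exists>!h. h \<in> Hom C Q T \<and> h \<cdot> (c \<cdot> a) = u \<and> h \<cdot> (c \<cdot> b) = v"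
    if u: "u \<in> Hom C K T" and v: "v \<in> Hom C M T" and uv: "v \<cdot> i = u \<cdot> f" for T u v
  proof -
    define w where "w = u \<cdot> x \<boxplus> v \<cdot> y"
    note w = biproduct_copair[OF S u v, folded w_def]
    have uf: "u \<cdot> f \<in> Hom C L T" and wn: "w \<cdot> n \<in> Hom C L T" using f u n(1) w(1) Comp_in_Hom by blast+
    have "w \<cdot> n \<boxplus> u \<cdot> f = u \<cdot> f"
      using Comp_Add[OF n(1) af w(1)] n(2) Comp_assoc[OF f SH(1) w(1)] Comp_assoc[OF i SH(2) w(1)]
        w(2,3) uv by simp
    then have "w \<cdot> n = Zer C L T"
      using Add_right_cancel[OF wn Zer_in_Hom uf] Zer_Add[OF uf] Hom_Obj[OF uf] by simp
    then have h: "\<exists>!h. h \<in> Hom C Q T \<and> h \<cdot> c = w" using c' w(1) by blast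
    have "h \<cdot> c = w \<longleftrightarrow> h \<cdot> (c \<cdot> a) = u \<and> h \<cdot> (c \<cdot> b) = v" if hH: "h \<in> Hom C Q T" for h
      using biproduct_copair_unique[OF S Comp_in_Hom[OF cH hH]] Comp_assoc[OF SH(1) cH hH]
        Comp_assoc[OF SH(2) cH hH] w unfolding w_def by metis
    with h show ?thesis by metis
  qed
  then have "is_pushout C i f (c \<cdot> a) (c \<cdot> b)" unfolding is_pushout_iff[OF i f ca cb] using comm by blast
  \<comment> \<open>A morphism into \<open>K\<close> that dies in \<open>Q\<close> comes from
    \<open>L\<close> through the kernel \<open>n\<close>, and its \<open>M\<close>-component, which
    is \<open>i \<cdot> e\<close>, is zero.\<close>
  moreover have "is_mono C (c \<cdot> a)" unfolding is_mono_iff[OF ca]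
  proof (intro allI ballI impI)
    fix T g assume g: "g \<in> Hom C T K" "(c \<cdot> a) \<cdot> g = Zer C T Q"
    have ag: "a \<cdot> g \<in> Hom C T S" using g(1) SH(1) by (rule Comp_in_Hom)
    have "c \<cdot> (a \<cdot> g) = Zer C T Q" using Comp_assoc[OF g(1) SH(1) cH] g(2) by simp
    then obtain e where e: "e \<in> Hom C T L" "n \<cdot> e = a \<cdot> g" using k' ag by blast
    have "i \<cdot> e = Zer C T M"
      using Comp_assoc[OF e(1) n(1) SH(4)] \<open>y \<cdot> n = i\<close> e(2) Comp_assoc[OF g(1) SH(1,4)] SH(8)
        Zer_Comp[OF g(1)] ob by simp
    then have "e = Zer C T L" using m e(1) unfolding is_mono_iff[OF i] by blast
    then have "a \<cdot> g = Zer C T S" using e(2) Comp_Zer[OF n(1)] Hom_Obj[OF g(1)] by simp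
    then show "g = Zer C T K"
      using Comp_assoc[OF g(1) SH(1,3)] SH(5) Id_Comp[OF g(1)] Comp_Zer[OF SH(3)] Hom_Obj[OF g(1)]
      by simp
  qed
  ultimately show ?thesis by blast
qed

text \<open>The monomorphism \<open>j\<close> of the push-out constructed before is
  \<open>h \<cdot> i'\<close> by the universal property, so \<open>i'\<close> is a
  monomorphism.\<close>

lemma pushout_is_mono:
  assumes m: "is_mono C i" and po: "is_pushout C i f i' f'"
  shows "is_mono C i'"
proof -
  have i: "i \<in> Hom C (Dom C i) (Cod C i)" and f: "f \<in> Hom C (Dom C i) (Cod C f)"
    using po unfolding is_pushout_def Hom_def by simp_all
  note ty = is_pushout_Hom[OF po i f]
  obtain j g where jg: "is_pushout C i f j g" and j: "is_mono C j"
    using mono_pushout_exists[OF m i f] by blast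
  note ty' = is_pushout_Hom[OF jg i f]
  have "g \<cdot> i = j \<cdot> f" using jg unfolding is_pushout_iff[OF i f ty'] by blast
  then obtain h where "h \<in> Hom C (Cod C i') (Cod C j)" "h \<cdot> i' = j"
    using po ty' unfolding is_pushout_iff[OF i f ty] by blast
  with is_mono_cancel[OF ty(1)] j show ?thesis by blast
qed

text \<open>The admissible monics and epics are the monomorphisms and epimorphisms; the epic half of
  the axioms is the monic half in the opposite category.\<close>

lemma short_exact_sequences_conflation_class: "conflation_class C (short_exact_sequences C)"
proof -
  interpret opp: abelian_category "opposite C" by (rule abelian_category_opposite)
  have epic: "admissible_epic (short_exact_sequences C) p \<longleftrightarrow> is_epi C p" for p
    using opp.admissible_monic_iff_mono by simp
  note adm = admissible_monic_iff_mono epic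
  have epi_pb: "\<exists>p' f'. is_pullback C p f p' f'" if "is_epi C p" "f \<in> Mor C" "Cod C f = Cod C p" for p f
    using opp.mono_pushout_exists[of p "Cod C p" "Dom C p" f "Dom C f"] that
    by (auto simp: Hom_def is_epi_def)
  have mono_po: "\<exists>i' f'. is_pushout C i f i' f'" if "is_mono C i" "f \<in> Mor C" "Dom C f = Dom C i" for i f
    using mono_pushout_exists[of i "Dom C i" "Cod C i" f "Cod C f"] that
    by (auto simp: Hom_def is_mono_def)
  show ?thesis
  proof
    show "(i, p') \<in> short_exact_sequences C"
      if "(i, p) \<in> short_exact_sequences C" "is_cokernel C p' i" for i p p'
      using that mono_kernel_cokernel kernel_is_mono unfolding kernel_cokernel_pairs_def by blast
    show "(i', p) \<in> short_exact_sequences C"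
      if "(i, p) \<in> short_exact_sequences C" "is_kernel C i' p" for i p i'
      using that opp.mono_kernel_cokernel[of p i'] opp.kernel_is_mono[of p i]
      unfolding kernel_cokernel_pairs_def by simp
    show "admissible_epic (short_exact_sequences C) (q \<cdot> p)"
      if "admissible_epic (short_exact_sequences C) p" "admissible_epic (short_exact_sequences C) q"
        "Cod C p = Dom C q" for p q
      using that opp.is_mono_Comp[of q p] by (simp add: adm)
    show "admissible_epic (short_exact_sequences C) p'"
      if "admissible_epic (short_exact_sequences C) p" "is_pullback C p f p' f'" for p f p' f'
      using that opp.pushout_is_mono[of p f p' f'] by (simp add: adm)
  qed (use is_mono_Comp pushout_is_mono epi_pb mono_po in \<open>simp_all only: adm order_refl\<close>)
qed

end


section \<open>Cotorsion pairs in abelian categories\<close>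

lemma right_perp_cong:
  assumes "U \<subseteq> Obj C" "\<And>M N. \<lbrakk>M \<in> Obj C; N \<in> Obj C\<rbrakk> \<Longrightarrow> van M N = van' M N"
  shows "right_perp C van U = right_perp C van' U"
  unfolding right_perp_def using assms by (metis subsetD)

lemma left_perp_cong:
  assumes "V \<subseteq> Obj C" "\<And>M N. \<lbrakk>M \<in> Obj C; N \<in> Obj C\<rbrakk> \<Longrightarrow> van M N = van' M N"
  shows "left_perp C van V = left_perp C van' V"
  unfolding left_perp_def using assms by (metis subsetD)

lemma is_cotorsion_pair_cong:
  assumes "\<And>M N. \<lbrakk>M \<in> Obj C; N \<in> Obj C\<rbrakk> \<Longrightarrow> van M N = van' M N"
  shows "is_cotorsion_pair C van U V \<longleftrightarrow> is_cotorsion_pair C van' U V"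
proof (cases "U \<subseteq> Obj C \<and> V \<subseteq> Obj C")
  case True
  then have "right_perp C van U = right_perp C van' U" "left_perp C van V = left_perp C van' V"
    using right_perp_cong[of U C van van', OF _ assms] left_perp_cong[of V C van van', OF _ assms]
    by simp_all
  then show ?thesis unfolding is_cotorsion_pair_def by simp
next
  case False
  then show ?thesis unfolding is_cotorsion_pair_def subcategory_def by blast
qed

lemma is_cotorsion_pair_opposite [simp]:
  "is_cotorsion_pair (opposite C) van V U \<longleftrightarrow> is_cotorsion_pair C (\<lambda>M N. van N M) U V"
  by (auto simp: is_cotorsion_pair_def)

lemma (in conflation_class) is_resolving_iff:
  "is_resolving C E U \<longleftrightarrow> projectives C E \<subseteq> U \<and>
     (\<forall>L M N i p. conflation C E L M N i p \<and> L \<in> U \<and> N \<in> U \<longrightarrow> M \<in> U) \<and>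
     (\<forall>L M N i p. conflation C E L M N i p \<and> M \<in> U \<and> N \<in> U \<longrightarrow> L \<in> U)"
proof -
  have 1: "(\<forall>L M N i p. conflation C E L M N i p \<and> P L M N \<longrightarrow> Q L M N) \<longleftrightarrow>
    (\<forall>i p. (i, p) \<in> E \<and> P (Dom C i) (Cod C i) (Cod C p) \<longrightarrow> Q (Dom C i) (Cod C i) (Cod C p))" for P Q
    using conflationI by (fastforce simp: conflation_def Hom_def)
  show ?thesis unfolding is_resolving_def
    using 1[of "\<lambda>L M N. L \<in> U \<and> N \<in> U" "\<lambda>L M N. M \<in> U"]
      1[of "\<lambda>L M N. M \<in> U \<and> N \<in> U" "\<lambda>L M N. L \<in> U"] by simp
qed

theorem corollary3p6:
  fixes \<A> :: "('o, 'm) precat" and \<E> :: "('m \<times> 'm) set" and \<X> \<Y> :: "'o set"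
  assumes "abelian_category \<A>"
    and "exact_structure \<A> \<E>"
    and "enough_projectives \<A> \<E>"
    and "enough_injectives \<A> \<E>"
    and "complete_hereditary_cotorsion_pair \<A> \<X> \<Y>"
  shows "(projectives \<A> \<E> \<subseteq> \<X> \<longrightarrow>
            complete_hereditary_rel_cotorsion_pair \<A> \<E> \<X> (rel_right_perp \<A> \<E> \<X>) \<and>
            (\<forall>A\<in>Obj \<A>. \<exists>j. is_preenvelope \<A> (rel_right_perp \<A> \<E> \<X>) A j \<and>
               is_mono \<A> j \<and> Coker_obj \<A> j \<in> \<X>)) \<and>
         (injectives \<A> \<E> \<subseteq> \<Y> \<longrightarrow>
            complete_hereditary_rel_cotorsion_pair \<A> \<E> (rel_left_perp \<A> \<E> \<Y>) \<Y> \<and>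
            (\<forall>A\<in>Obj \<A>. \<exists>p. is_precover \<A> (rel_left_perp \<A> \<E> \<Y>) A p \<and>
               is_epi \<A> p \<and> Ker_obj \<A> p \<in> \<Y>))"
proof -
  interpret abelian_category \<A> by fact
  let ?S = "short_exact_sequences \<A>"
  interpret S: conflation_class \<A> ?S by (rule short_exact_sequences_conflation_class)
  interpret E: conflation_class \<A> \<E> using assms(2) by (rule exact_structure_conflation_class)
  note ES = E.kernel_cokernel
  have pair1: "is_cotorsion_pair \<A> (Ext1_vanishes \<A>) \<X> \<Y>"
    and complete: "is_complete \<A> ?S \<X> \<Y>" and res: "is_resolving \<A> ?S \<X>"
    using assms(5) unfolding complete_hereditary_cotorsion_pair_def by blast+
  have ext1: "Ext1_vanishes \<A> M N = splits \<A> ?S M N" if "M \<in> Obj \<A>" "N \<in> Obj \<A>" for M N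
    using S.Ext1_vanishes_iff_splits[OF refl direct_sums] that by blast
  have pair: "is_cotorsion_pair \<A> (splits \<A> ?S) \<X> \<Y>"
    by (rule is_cotorsion_pair_cong[OF ext1, THEN iffD1, OF _ _ pair1])
  then have Y: "\<Y> = right_perp \<A> (splits \<A> ?S) \<X>"
    and "subcategory \<A> \<X>" "subcategory \<A> \<Y>"
    unfolding is_cotorsion_pair_def by - (elim conjE, assumption)+
  then have XO: "\<X> \<subseteq> Obj \<A>" and YO: "\<Y> \<subseteq> Obj \<A>" unfolding subcategory_def by - (elim conjE, assumption)+
  have X_kernel: "L \<in> \<X>" if "conflation \<A> ?S L M N i p" "M \<in> \<X>" "N \<in> \<X>" for L M N i p
    using res that unfolding S.is_resolving_iff by blast
  \<comment> \<open>The hereditary condition speaks of \<open>\<X>\<close>; this is its counterpart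
    for \<open>\<Y>\<close>, in the form that the dual part uses.\<close>
  have Y_cokernel: "N \<in> \<Y>" if "conflation \<A> ?S L M N i p" "L \<in> \<Y>" "M \<in> \<Y>" for L M N i p
    by (rule S.right_perp_cokernel[OF complete Y _ that]) (rule X_kernel)
  have conflation_S: "conflation \<A> ?S L M N i p" if "conflation \<A> \<E> L M N i p" for L M N i p
    using that ES unfolding conflation_def by blast
  have ext: "rel_Ext1_vanishes \<A> \<E> M N = splits \<A> \<E> M N" if "M \<in> Obj \<A>" "N \<in> Obj \<A>" for M N
    using E.rel_Ext1_vanishes_iff_splits[OF assms(3)] that by blast
  have pair_ext: "is_cotorsion_pair \<A> (rel_Ext1_vanishes \<A> \<E>) U V \<longleftrightarrow>
      is_cotorsion_pair \<A> (splits \<A> \<E>) U V" for U V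
    using ext by (rule is_cotorsion_pair_cong)
  show ?thesis
  proof (intro conjI impI)
    assume proj: "projectives \<A> \<E> \<subseteq> \<X>"
    have W: "rel_right_perp \<A> \<E> \<X> = right_perp \<A> (splits \<A> \<E>) \<X>"
      using XO ext by (rule right_perp_cong)
    note * = E.relative_cotorsion_pair[OF S.conflation_class_axioms ES assms(3,4) pair complete proj]
    \<comment> \<open>Conflations are short exact sequences, so both closure properties are
      inherited; the relative projectives are covered by \<open>proj\<close>.\<close>
    have "is_resolving \<A> \<E> \<X>"
      using res proj conflation_S unfolding E.is_resolving_iff S.is_resolving_iff by blast
    with * show "complete_hereditary_rel_cotorsion_pair \<A> \<E> \<X> (rel_right_perp \<A> \<E> \<X>)"
      unfolding W complete_hereditary_rel_cotorsion_pair_def pair_ext by blast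
    show "\<forall>A\<in>Obj \<A>. \<exists>j. is_preenvelope \<A> (rel_right_perp \<A> \<E> \<X>) A j \<and>
               is_mono \<A> j \<and> Coker_obj \<A> j \<in> \<X>"
      using * unfolding W by blast
  next
    assume inj: "injectives \<A> \<E> \<subseteq> \<Y>"
    have W: "rel_left_perp \<A> \<E> \<Y> = left_perp \<A> (splits \<A> \<E>) \<Y>"
      using YO ext by (rule left_perp_cong)
    \<comment> \<open>The first part in the opposite category, where \<open>\<X>\<close> and
      \<open>\<Y>\<close> exchange their roles.\<close>
    have *: "is_cotorsion_pair \<A> (splits \<A> \<E>) (left_perp \<A> (splits \<A> \<E>) \<Y>) \<Y> \<and>
        is_complete \<A> \<E> (left_perp \<A> (splits \<A> \<E>) \<Y>) \<Y> \<and>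
        (\<forall>A\<in>Obj \<A>. \<exists>p. is_precover \<A> (left_perp \<A> (splits \<A> \<E>) \<Y>) A p \<and>
          is_epi \<A> p \<and> Ker_obj \<A> p \<in> \<Y>)"
      using conflation_class.relative_cotorsion_pair[OF E.conflation_class_opposite
          S.conflation_class_opposite, of \<Y> \<X>] ES assms(3,4) pair complete inj
      by simp
    \<comment> \<open>Duality gives the pair and its completeness, but being resolving is not a
      self-dual condition, so it is checked directly.\<close>
    have "is_resolving \<A> \<E> (left_perp \<A> (splits \<A> \<E>) \<Y>)"
      unfolding E.is_resolving_iff
    proof (intro conjI allI impI)
      show "projectives \<A> \<E> \<subseteq> left_perp \<A> (splits \<A> \<E>) \<Y>"
        using E.projective_splits unfolding left_perp_def projectives_def by blast
      show "M \<in> left_perp \<A> (splits \<A> \<E>) \<Y>"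
        if "conflation \<A> \<E> L M N i p \<and> L \<in> left_perp \<A> (splits \<A> \<E>) \<Y> \<and>
          N \<in> left_perp \<A> (splits \<A> \<E>) \<Y>" for L M N i p
        using that E.left_perp_extension by blast
      \<comment> \<open>The dual of \<open>right_perp_cokernel\<close> applies: the closure it asks
        for is that of \<open>\<Y>\<close> under cokernels of admissible monics.\<close>
      show "L \<in> left_perp \<A> (splits \<A> \<E>) \<Y>"
        if c: "conflation \<A> \<E> L M N i p \<and> M \<in> left_perp \<A> (splits \<A> \<E>) \<Y> \<and>
          N \<in> left_perp \<A> (splits \<A> \<E>) \<Y>" for L M N i p
      proof (rule E.left_perp_kernel[OF _ refl])
        show "is_complete \<A> \<E> (left_perp \<A> (splits \<A> \<E>) \<Y>) \<Y>" using * by blast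
        \<comment> \<open>In this dual reading \<open>p'\<close> is the monic and \<open>i'\<close>
          the epic of the conflation.\<close>
        show "L' \<in> \<Y>" if "conflation \<A> \<E> N' M' L' p' i'" "M' \<in> \<Y>" "N' \<in> \<Y>"
          for N' M' L' p' i'
          using conflation_S[OF that(1)] that(3,2) by (rule Y_cokernel)
      qed (use c in blast)+
    qed
    with * show "complete_hereditary_rel_cotorsion_pair \<A> \<E> (rel_left_perp \<A> \<E> \<Y>) \<Y>"
      unfolding W complete_hereditary_rel_cotorsion_pair_def pair_ext by blast
    show "\<forall>A\<in>Obj \<A>. \<exists>p. is_precover \<A> (rel_left_perp \<A> \<E> \<Y>) A p \<and>
               is_epi \<A> p \<and> Ker_obj \<A> p \<in> \<Y>"
      using * unfolding W by blast
  qed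
qed

end
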